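(* Let $X$ be a Hausdorff locally convex topological vector space and let $\hat A:\mathcal{D}(\hat A)\subset X\to X$ be a linear operator. Consider the following two statements. (i) $\hat A$ is the infinitesimal generator of a $C_0$-sequentially equicontinuous semigroup $\hat T$ on $X$ such that, for every $x\in X$ and $\lambda>0$, the generalized Riemann integral $\int_0^{+\infty}e^{-\lambda t}\hat T_tx\,dt$ exists in $X$. (ii) $\hat A$ is a sequentially closed linear operator, $\mathcal{D}(\hat A)$ is sequentially dense in $X$, and there exists a sequence $\{\lambda_n\}_{n\in\mathbb{N}}\subset\rho_0(\hat A)$, with $\lambda_n\to+\infty$, such that the family $\left\{\left(\lambda_nR(\lambda_n,\hat A)\right)^m\right\}_{n,m\in\mathbb{N}}$ is sequentially equicontinuous. Then (i) implies (ii). If $X$ is sequentially complete, then (ii) implies (i).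
   Context: $\mathbb{R}^+=[0,+\infty)$. A family $\{f_\iota:X\to X\}_{\iota\in\mathcal{I}}$ is sequentially equicontinuous if for every $x\in X$, every sequence $x_n\to x$ in $X$ and every neighborhood $U$ of $0$ in $X$ there is $\overline n$ such that $f_\iota(x_n)\in f_\iota(x)+U$ for all $\iota\in\mathcal{I}$ and $n\ge\overline n$. A $C_0$-sequentially equicontinuous semigroup on $X$ is a family $T=\{T_t:X\to X\}_{t\in\mathbb{R}^+}$ of linear operators (not assumed continuous) such that: $T_0=I$ and $T_{t+s}=T_tT_s$ for all $t,s\ge0$; $\lim_{t\to0^+}T_tx=x$ for every $x\in X$; $T$ is a sequentially equicontinuous family. Its infinitesimal generator $A$ has domain $\mathcal{D}(A)=\{x\in X:\ \lim_{h\to0^+}\frac{T_hx-x}{h}\text{ exists in }X\}$ and $Ax=\lim_{h\to0^+}\frac{T_hx-x}{h}$. The generalized Riemann integral $\int_0^{+\infty}e^{-\lambda t}T_tx\,dt$ exists in $X$ if for every $a\ge0$ the Riemann integral over $[0,a]$ exists in $X$ and its limit as $a\to+\infty$ exists in $X$. (If $X$ is sequentially complete this holds automatically for every $C_0$-sequentially equicontinuous semigroup.) A linear operator is sequentially closed if its graph is sequentially closed in $X\times X$. A subset $U\subset X$ is sequentially dense if every $x\in X$ is the limit of a sequence in $U$. $X$ is sequentially complete if every Cauchy sequence converges. For a linear operator $C:\mathcal{D}(C)\subset X\to X$, $\rho_0(C)$ is the set of $\lambda\in\mathbb{R}$ such that $\lambda-C:\mathcal{D}(C)\to X$ is one-to-one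 and onto and $R(\lambda,C):=(\lambda-C)^{-1}:X\to X$ is sequentially continuous. *)

theory Defs
  imports "HOL-Analysis.Analysis"
begin

section \<open>Hausdorff locally convex topological vector spaces\<close>

text \<open>The condition on \<open>V\<close> spells out \<open>convex V\<close>, a constant that cannot be used inside a class
  specification because of its sort constraint.\<close>

class locally_convex_t2_space = real_vector + t2_space + topological_ab_group_add +
  assumes tendsto_scaleR_nhds_prod:
    "((\<lambda>(c, x). c *\<^sub>R x) \<longlongrightarrow> c0 *\<^sub>R x0) (nhds c0 \<times>\<^sub>F nhds x0)"
  assumes convex_neighborhood_0:
    "open U \<Longrightarrow> 0 \<in> U \<Longrightarrow> \<exists>V. open V \<and>
      (\<forall>x\<in>V. \<forall>y\<in>V. \<forall>u\<ge>0. \<forall>v\<ge>0. u + v = 1 \<longrightarrow> u *\<^sub>R x + v *\<^sub>R y \<in> V) \<and> 0 \<in> V \<and> V \<subseteq> U"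

instance real_normed_vector \<subseteq> locally_convex_t2_space
proof
  fix c0 :: real and x0 :: 'a
  show "((\<lambda>(c, x). c *\<^sub>R x) \<longlongrightarrow> c0 *\<^sub>R x0) (nhds c0 \<times>\<^sub>F nhds x0)"
    unfolding case_prod_beta
    by (intro tendsto_scaleR filterlim_fst filterlim_snd)
next
  fix U :: "'a set"
  assume "open U" "0 \<in> U"
  then obtain e where "0 < e" "ball 0 e \<subseteq> U"
    using open_contains_ball by blast
  then show "\<exists>V. open V \<and>
      (\<forall>x\<in>V. \<forall>y\<in>V. \<forall>u\<ge>0. \<forall>v\<ge>0. u + v = 1 \<longrightarrow> u *\<^sub>R x + v *\<^sub>R y \<in> V) \<and> 0 \<in> V \<and> V \<subseteq> U"
    using convex_ball[of "0 :: 'a" e] unfolding convex_def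
    by (intro exI[of _ "ball 0 e"]) auto
qed

text \<open>The Cauchy property with respect to the canonical uniformity of the additive group;
  the library's \<^const>\<open>Cauchy\<close> needs a uniformity as part of the type class.\<close>

definition tvs_Cauchy :: "(nat \<Rightarrow> 'a::locally_convex_t2_space) \<Rightarrow> bool" where
  "tvs_Cauchy xs \<longleftrightarrow> (\<forall>U. open U \<and> 0 \<in> U \<longrightarrow> (\<exists>N. \<forall>n\<ge>N. \<forall>m\<ge>N. xs n - xs m \<in> U))"


section \<open>Sequential notions\<close>

definition seq_closed :: "'a::topological_space set \<Rightarrow> bool" where
  "seq_closed S \<longleftrightarrow> (\<forall>xs x. (\<forall>n. xs n \<in> S) \<and> xs \<longlonglongrightarrow> x \<longrightarrow> x \<in> S)"

definition seq_dense :: "'a::topological_space set \<Rightarrow> bool" where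
  "seq_dense S \<longleftrightarrow> (\<forall>x. \<exists>xs. (\<forall>n. xs n \<in> S) \<and> xs \<longlonglongrightarrow> x)"

definition seq_continuous :: "('a::topological_space \<Rightarrow> 'b::topological_space) \<Rightarrow> bool" where
  "seq_continuous f \<longleftrightarrow> (\<forall>xs x. xs \<longlonglongrightarrow> x \<longrightarrow> (\<lambda>n. f (xs n)) \<longlonglongrightarrow> f x)"

definition seq_equicontinuous ::
    "'i set \<Rightarrow> ('i \<Rightarrow> 'a \<Rightarrow> 'a::locally_convex_t2_space) \<Rightarrow> bool" where
  "seq_equicontinuous I f \<longleftrightarrow>
    (\<forall>x xs U. xs \<longlonglongrightarrow> x \<and> open U \<and> 0 \<in> U \<longrightarrow>
      (\<exists>N. \<forall>i\<in>I. \<forall>n\<ge>N. f i (xs n) - f i x \<in> U))"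


section \<open>Riemann integrals\<close>

text \<open>The limit of Riemann sums as the mesh tends to zero. The library's integrals require
  values in a normed space, and its \<^const>\<open>has_integral\<close> is moreover the gauge integral.
  Here \<^term>\<open>measure lborel k\<close> is the length of the interval \<^term>\<open>k\<close>.\<close>

definition has_riemann_integral ::
    "(real \<Rightarrow> 'a::locally_convex_t2_space) \<Rightarrow> 'a \<Rightarrow> real \<Rightarrow> real \<Rightarrow> bool" where
  "has_riemann_integral f J a b \<longleftrightarrow>
    (\<forall>U. open U \<and> 0 \<in> U \<longrightarrow>
      (\<exists>\<delta>>0. \<forall>p. p tagged_division_of {a..b} \<and> (\<forall>(t, k)\<in>p. measure lborel k < \<delta>) \<longrightarrow>
        (\<Sum>(t, k)\<in>p. measure lborel k *\<^sub>R f t) - J \<in> U))"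

definition improper_riemann_integral_exists ::
    "(real \<Rightarrow> 'a::locally_convex_t2_space) \<Rightarrow> bool" where
  "improper_riemann_integral_exists f \<longleftrightarrow>
    (\<exists>J l. (\<forall>a\<ge>0. has_riemann_integral f (J a) 0 a) \<and> (J \<longlongrightarrow> l) at_top)"


section \<open>Partially defined linear operators\<close>

text \<open>An operator with domain \<open>D\<close> is given by \<open>D\<close> together with a total function \<open>A\<close> whose
  values outside \<open>D\<close> are irrelevant.\<close>

definition linear_operator :: "'a::real_vector set \<Rightarrow> ('a \<Rightarrow> 'a) \<Rightarrow> bool" where
  "linear_operator D A \<longleftrightarrow> subspace D \<and>
    (\<forall>x\<in>D. \<forall>y\<in>D. A (x + y) = A x + A y) \<and> (\<forall>c. \<forall>x\<in>D. A (c *\<^sub>R x) = c *\<^sub>R A x)"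

definition seq_closed_operator ::
    "'a::locally_convex_t2_space set \<Rightarrow> ('a \<Rightarrow> 'a) \<Rightarrow> bool" where
  "seq_closed_operator D A \<longleftrightarrow> linear_operator D A \<and> seq_closed {(x, A x) | x. x \<in> D}"

definition resolvent :: "'a::real_vector set \<Rightarrow> ('a \<Rightarrow> 'a) \<Rightarrow> real \<Rightarrow> 'a \<Rightarrow> 'a" where
  "resolvent D A l = the_inv_into D (\<lambda>x. l *\<^sub>R x - A x)"

definition resolvent_set0 ::
    "'a::locally_convex_t2_space set \<Rightarrow> ('a \<Rightarrow> 'a) \<Rightarrow> real set" where
  "resolvent_set0 D A =
    {l. bij_betw (\<lambda>x. l *\<^sub>R x - A x) D UNIV \<and> seq_continuous (resolvent D A l)}"


section \<open>Semigroups and generators\<close>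

text \<open>Only the values of the semigroup at times \<open>t \<ge> 0\<close> are relevant.\<close>

definition C0_seq_equicontinuous_semigroup ::
    "(real \<Rightarrow> 'a \<Rightarrow> 'a::locally_convex_t2_space) \<Rightarrow> bool" where
  "C0_seq_equicontinuous_semigroup T \<longleftrightarrow>
    (\<forall>t\<ge>0. linear (T t)) \<and>
    T 0 = id \<and> (\<forall>t\<ge>0. \<forall>s\<ge>0. T (t + s) = T t \<circ> T s) \<and>
    (\<forall>x. ((\<lambda>t. T t x) \<longlongrightarrow> x) (at_right 0)) \<and>
    seq_equicontinuous {0..} T"

definition generator_domain ::
    "(real \<Rightarrow> 'a \<Rightarrow> 'a::locally_convex_t2_space) \<Rightarrow> 'a set" where
  "generator_domain T =
    {x. \<exists>y. ((\<lambda>h. (1 / h) *\<^sub>R (T h x - x)) \<longlongrightarrow> y) (at_right 0)}"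

definition generator ::
    "(real \<Rightarrow> 'a \<Rightarrow> 'a::locally_convex_t2_space) \<Rightarrow> 'a \<Rightarrow> 'a" where
  "generator T x = Lim (at_right 0) (\<lambda>h. (1 / h) *\<^sub>R (T h x - x))"

definition is_generator ::
    "'a::locally_convex_t2_space set \<Rightarrow> ('a \<Rightarrow> 'a) \<Rightarrow> (real \<Rightarrow> 'a \<Rightarrow> 'a) \<Rightarrow> bool" where
  "is_generator D A T \<longleftrightarrow> D = generator_domain T \<and> (\<forall>x\<in>D. A x = generator T x)"

end

theory Submission
  imports Defs
begin

text \<open>
  Continuous seminorms determine the topology, and a family of linear operators \<open>f\<^sub>i\<close> is sequentially
  equicontinuous exactly when every continuous seminorm \<open>p\<close> is dominated along the family,
  \<open>p (f\<^sub>i x) \<le> q x\<close>, by a seminorm \<open>q\<close> that is continuous along sequences; one can take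
  \<open>q x = sup\<^sub>i p (f\<^sub>i x)\<close> (\<open>seq_seminorm_sup_seminorm\<close>, \<open>seq_equicontinuousI\<close>). All arguments below
  are estimates with such pairs \<open>p\<close>, \<open>q\<close>.

  From the semigroup to the resolvents: let \<open>R x\<close> be the integral of \<open>exp (- \<lambda> t) T\<^sub>t x\<close> over
  \<open>t \<ge> 0\<close>. Shifting the integral gives \<open>T\<^sub>h (R x) = exp (\<lambda> h) (R x - I\<^sub>h)\<close>, where \<open>I\<^sub>h\<close> is the part of
  the integral over \<open>[0, h]\<close>. Since \<open>I\<^sub>h / h\<close> tends to \<open>x\<close>, the vector \<open>R x\<close> is in the domain of
  the generator, which maps it to \<open>\<lambda> R x - x\<close>; as \<open>R\<close> commutes with the semigroup and is
  sequentially continuous, it is the resolvent. The seminorm \<open>q x = sup\<^sub>t p (T\<^sub>t x)\<close> does not increase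
  under any \<open>T\<^sub>t\<close>, hence not under \<open>\<lambda> R\<close>, which is a weighted mean of the \<open>T\<^sub>t\<close>; so \<open>q\<close> controls
  all powers of all the \<open>\<lambda> R\<close> at once (\<open>orbit_sup_laplace_power\<close>). The vectors \<open>I\<^sub>h / h\<close> are in the
  range of \<open>R\<close>, which shows density.

  From the resolvents to the semigroup: let \<open>J\<^sub>n = \<lambda>\<^sub>n R(\<lambda>\<^sub>n)\<close>. This is one step of length
  \<open>1 / \<lambda>\<^sub>n\<close> of the implicit Euler scheme for \<open>u' = A u\<close>, so that the semigroup is obtained as
  \<open>T\<^sub>t x = lim J\<^sub>n\<^sup>k x\<close> with \<open>k = \<lfloor>\<lambda>\<^sub>n t\<rfloor>\<close>. To compare the schemes for \<open>\<lambda>\<^sub>n \<le> \<lambda>\<^sub>m\<close>, put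
  \<open>Q x = sup\<^sub>k p (J\<^sub>m\<^sup>k x)\<close>. Clearly \<open>J\<^sub>m\<close> is nonexpansive for \<open>Q\<close>, and the resolvent identity, which
  writes \<open>J\<^sub>n y\<close> as \<open>J\<^sub>m\<close> of a convex combination of \<open>y\<close> and \<open>J\<^sub>n y\<close>, shows that \<open>J\<^sub>n\<close> is
  nonexpansive too. For such a pair the estimate of Crandall and Liggett
  (\<open>crandall_liggett_estimate\<close>) bounds the difference of \<open>J\<^sub>n\<^sup>k x\<close> and \<open>J\<^sub>m\<^sup>l x\<close> for \<open>x\<close> in the
  domain, and \<open>Q\<close> is dominated by the supremum over both indices, which does not depend on
  \<open>m\<close>. So the limits exist on the domain, and everywhere by density. Finally the generator \<open>B\<close> of
  \<open>T\<close> extends \<open>A\<close>; as \<open>\<lambda> - A\<close> is onto for some \<open>\<lambda> > 0\<close> for which \<open>\<lambda> - B\<close> is one-to-one, by the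
  first half, the two operators agree.
\<close>

section \<open>Seminorms\<close>

definition seminorm :: "('a::real_vector \<Rightarrow> real) \<Rightarrow> bool" where
  "seminorm p \<longleftrightarrow> (\<forall>x y. p (x + y) \<le> p x + p y) \<and> (\<forall>c x. p (c *\<^sub>R x) = \<bar>c\<bar> * p x)"

lemma seminorm_add: "seminorm p \<Longrightarrow> p (x + y) \<le> p x + p y"
  and seminorm_scaleR: "seminorm p \<Longrightarrow> p (c *\<^sub>R x) = \<bar>c\<bar> * p x"
  by (auto simp: seminorm_def)

lemma seminorm_0: "seminorm p \<Longrightarrow> p 0 = 0"
  using seminorm_scaleR[of p 0 0] by simp

lemma seminorm_minus: "seminorm p \<Longrightarrow> p (- x) = p x"
  using seminorm_scaleR[of p "-1" x] by simp

lemma seminorm_nonneg: "seminorm p \<Longrightarrow> 0 \<le> p x"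
  using seminorm_add[of p x "- x"] by (simp add: seminorm_0 seminorm_minus)

lemma seminorm_diff: "seminorm p \<Longrightarrow> p (x - y) \<le> p x + p y"
  using seminorm_add[of p x "- y"] by (simp add: seminorm_minus)

lemma seminorm_diff_commute: "seminorm p \<Longrightarrow> p (x - y) = p (y - x)"
  using seminorm_minus[of p "x - y"] by simp

lemma seminorm_triangle: "seminorm p \<Longrightarrow> p (x - z) \<le> p (x - y) + p (y - z)"
  using seminorm_add[of p "x - y" "y - z"] by simp

lemma seminorm_le_diff: "seminorm p \<Longrightarrow> p x \<le> p y + p (x - y)"
  using seminorm_add[of p y "x - y"] by simp

lemma seminorm_sum: "seminorm p \<Longrightarrow> p (sum f S) \<le> (\<Sum>i\<in>S. p (f i))"
proof (induction S rule: infinite_finite_induct)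
  case (insert i S)
  then show ?case
    using seminorm_add[of p "f i" "sum f S"] by simp
qed (simp_all add: seminorm_0)

definition cont_seminorm :: "('a::locally_convex_t2_space \<Rightarrow> real) \<Rightarrow> bool" where
  "cont_seminorm p \<longleftrightarrow> seminorm p \<and> (p \<longlongrightarrow> 0) (nhds 0)"

text \<open>Suprema of continuous seminorms over sequentially equicontinuous families satisfy in general
  only this weaker form of continuity: the topology need not be determined by its convergent sequences.\<close>

definition seq_seminorm :: "('a::locally_convex_t2_space \<Rightarrow> real) \<Rightarrow> bool" where
  "seq_seminorm q \<longleftrightarrow> seminorm q \<and> (\<forall>xs. xs \<longlonglongrightarrow> 0 \<longrightarrow> (\<lambda>n. q (xs n)) \<longlonglongrightarrow> 0)"

lemma cont_seminorm_imp_seq_seminorm: "cont_seminorm p \<Longrightarrow> seq_seminorm p"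
  unfolding cont_seminorm_def seq_seminorm_def by (blast intro: filterlim_compose)

lemma tendsto_scaleR_lc:
  fixes g :: "'b \<Rightarrow> 'a::locally_convex_t2_space"
  assumes "(f \<longlongrightarrow> c) F" "(g \<longlongrightarrow> x) F"
  shows "((\<lambda>i. f i *\<^sub>R g i) \<longlongrightarrow> c *\<^sub>R x) F"
  using filterlim_compose[OF tendsto_scaleR_nhds_prod filterlim_Pair[OF assms]] by simp

text \<open>The seminorm is the Minkowski functional of a convex neighborhood made symmetric.\<close>

lemma exists_cont_seminorm:
  fixes U :: "'a::locally_convex_t2_space set"
  assumes "open U" "0 \<in> U"
  shows "\<exists>p. cont_seminorm p \<and> (\<forall>x. p x < 1 \<longrightarrow> x \<in> U)"
proof -
  obtain V where V: "open V" "0 \<in> V" "V \<subseteq> U"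
    and V_conv: "\<forall>x\<in>V. \<forall>y\<in>V. \<forall>u\<ge>0. \<forall>v\<ge>0. u + v = 1 \<longrightarrow> u *\<^sub>R x + v *\<^sub>R y \<in> V"
    using convex_neighborhood_0[OF assms] by (elim exE conjE) (rule that)
  have convV: "u *\<^sub>R x + v *\<^sub>R y \<in> V" if "x \<in> V" "y \<in> V" "u \<ge> 0" "v \<ge> 0" "u + v = 1" for x y u v
    using V_conv that by simp
  define W where "W = {x. x \<in> V \<and> - x \<in> V}"
  have W0: "0 \<in> W" and WV: "W \<subseteq> V" and Wminus: "\<And>x. x \<in> W \<Longrightarrow> - x \<in> W"
    using V by (auto simp: W_def)
  have convW: "u *\<^sub>R x + v *\<^sub>R y \<in> W" if "x \<in> W" "y \<in> W" "u \<ge> 0" "v \<ge> 0" "u + v = 1" for x y u v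
    using convV[of x y u v] convV[of "-x" "-y" u v] that by (simp add: W_def)
  have scaleW: "u *\<^sub>R x \<in> W" if "x \<in> W" "0 \<le> u" "u \<le> 1" for x u
    using convW[OF that(1) W0, of u "1 - u"] that by simp
  have nbhW: "eventually (\<lambda>x. x \<in> W) (nhds 0)"
  proof -
    have "eventually (\<lambda>x. x \<in> V) (nhds (0::'a))"
      using V by (auto intro: eventually_nhds_in_open)
    moreover have "((\<lambda>x::'a. - x) \<longlongrightarrow> - 0) (nhds 0)"
      by (intro tendsto_minus) (simp add: filterlim_ident)
    then have "eventually (\<lambda>x::'a. - x \<in> V) (nhds 0)"
      using V by (auto dest: topological_tendstoD)
    ultimately show ?thesis
      unfolding W_def by (simp add: eventually_conj)
  qed
  have "eventually (\<lambda>x. c *\<^sub>R x \<in> W) (nhds 0)" for c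
  proof -
    have "((\<lambda>x::'a. c *\<^sub>R x) \<longlongrightarrow> c *\<^sub>R 0) (nhds 0)"
      by (intro tendsto_scaleR_lc tendsto_const) (simp add: filterlim_ident)
    then show ?thesis
      using nbhW unfolding filterlim_iff by auto
  qed
  note nbh_scaled = this
  define S where "S x = {t::real. t > 0 \<and> (1 / t) *\<^sub>R x \<in> W}" for x
  define p where "p x = Inf (S x)" for x
  have bdd: "bdd_below (S x)" for x
    by (auto simp: S_def intro!: bdd_belowI[of _ 0])
  have ne: "S x \<noteq> {}" for x
  proof -
    have "((\<lambda>n. (1 / real (Suc n)) *\<^sub>R x) \<longlongrightarrow> 0 *\<^sub>R x) sequentially"
      by (intro tendsto_scaleR_lc tendsto_const) (rule LIMSEQ_Suc[OF lim_1_over_n])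
    then have "eventually (\<lambda>n. (1 / real (Suc n)) *\<^sub>R x \<in> W) sequentially"
      using nbhW unfolding filterlim_iff by auto
    then obtain n where "(1 / real (Suc n)) *\<^sub>R x \<in> W"
      by (auto simp: eventually_sequentially)
    then have "real (Suc n) \<in> S x"
      by (simp add: S_def)
    then show ?thesis by blast
  qed
  have up: "s \<in> S x" if "t \<in> S x" "t \<le> s" for s t x
  proof -
    have "(t / s) *\<^sub>R ((1 / t) *\<^sub>R x) \<in> W"
      using that scaleW[of "(1 / t) *\<^sub>R x" "t / s"] by (auto simp: S_def)
    then show ?thesis using that by (auto simp: S_def)
  qed
  \<comment> \<open>the infimum need not be attained, but \<open>S x\<close> contains every number above it\<close>
  have less_mem: "s \<in> S x" if "p x < s" for x s
    using cInf_lessD[OF ne, of x s] that up[of _ x s] by (force simp: p_def)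
  have p_le: "p x \<le> t" if "t \<in> S x" for x t
    unfolding p_def using that by (rule cInf_lower[OF _ bdd])
  have p_ge0: "0 \<le> p x" for x
    unfolding p_def by (rule cInf_greatest[OF ne]) (auto simp: S_def)
  have sub: "p (x + y) \<le> p x + p y" for x y
  proof (rule field_le_epsilon)
    fix e :: real assume e: "e > 0"
    define t s where "t = p x + e / 2" and "s = p y + e / 2"
    have ts: "t \<in> S x" "s \<in> S y"
      using e by (auto simp: t_def s_def intro: less_mem)
    then have pos: "t > 0" "s > 0" by (auto simp: S_def)
    \<comment> \<open>\<open>(x + y) / (t + s)\<close> is a convex combination of \<open>x / t\<close> and \<open>y / s\<close>\<close>
    have "(t / (t + s)) *\<^sub>R ((1 / t) *\<^sub>R x) + (s / (t + s)) *\<^sub>R ((1 / s) *\<^sub>R y) \<in> W"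
      using ts pos by (intro convW) (auto simp: S_def add_divide_distrib[symmetric])
    then have "(1 / (t + s)) *\<^sub>R (x + y) \<in> W"
      using pos by (simp add: scaleR_add_right)
    then have "t + s \<in> S (x + y)" using pos by (simp add: S_def)
    then show "p (x + y) \<le> p x + p y + e"
      using p_le[of "t + s" "x + y"] by (simp add: t_def s_def)
  qed
  have scale_le: "p (c *\<^sub>R x) \<le> \<bar>c\<bar> * p x" if "c \<noteq> 0" for c x
  proof -
    have "p (c *\<^sub>R x) / \<bar>c\<bar> \<le> t" if "t \<in> S x" for t
    proof -
      have t: "t > 0" "(1 / t) *\<^sub>R x \<in> W" using that by (auto simp: S_def)
      have "(c / \<bar>c\<bar>) *\<^sub>R ((1 / t) *\<^sub>R x) \<in> W"
        using t(2) Wminus[OF t(2)] \<open>c \<noteq> 0\<close> by (cases "c > 0") auto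
      then have "\<bar>c\<bar> * t \<in> S (c *\<^sub>R x)"
        using t(1) \<open>c \<noteq> 0\<close> by (simp add: S_def)
      then show ?thesis
        using p_le[of "\<bar>c\<bar> * t" "c *\<^sub>R x"] \<open>c \<noteq> 0\<close> by (simp add: field_simps)
    qed
    then have "p (c *\<^sub>R x) / \<bar>c\<bar> \<le> p x"
      unfolding p_def[of x] by (intro cInf_greatest[OF ne])
    then show ?thesis using that by (simp add: field_simps)
  qed
  have p0: "p 0 = 0"
  proof (rule antisym)
    show "p 0 \<le> 0"
      by (rule field_le_epsilon) (auto intro: p_le simp: S_def W0)
  qed (rule p_ge0)
  have "p (c *\<^sub>R x) = \<bar>c\<bar> * p x" for c x
  proof (cases "c = 0")
    case False
    have "p x \<le> \<bar>1 / c\<bar> * p (c *\<^sub>R x)"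
      using scale_le[of "1 / c" "c *\<^sub>R x"] False by simp
    then show ?thesis
      using scale_le[of c x] False by (simp add: field_simps)
  qed (simp add: p0)
  then have semi: "seminorm p"
    using sub by (simp add: seminorm_def)
  moreover have "(p \<longlongrightarrow> 0) (nhds 0)"
  proof (rule tendstoI)
    fix e :: real assume e: "e > 0"
    have "eventually (\<lambda>x. (1 / (e / 2)) *\<^sub>R x \<in> W) (nhds 0)"
      by (rule nbh_scaled)
    then show "eventually (\<lambda>x. dist (p x) 0 < e) (nhds 0)"
    proof eventually_elim
      case (elim x)
      then have "p x \<le> e / 2" using e by (intro p_le) (simp add: S_def)
      then show ?case using e p_ge0[of x] by simp
    qed
  qed
  moreover have "x \<in> U" if "p x < 1" for x
    using less_mem[OF that] WV V by (auto simp: S_def)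
  ultimately show ?thesis
    unfolding cont_seminorm_def by blast
qed

lemma cont_seminorm_imp_seminorm: "cont_seminorm p \<Longrightarrow> seminorm p"
  by (simp add: cont_seminorm_def)

lemma seq_seminorm_imp_seminorm: "seq_seminorm p \<Longrightarrow> seminorm p"
  by (simp add: seq_seminorm_def)

lemma tendsto_cont_seminorm:
  fixes l :: "'a::locally_convex_t2_space"
  assumes "cont_seminorm p" "(f \<longlongrightarrow> l) F"
  shows "((\<lambda>i. p (f i - l)) \<longlongrightarrow> 0) F"
proof -
  have "((\<lambda>i. f i - l) \<longlongrightarrow> 0) F"
    using tendsto_diff[OF assms(2) tendsto_const[of l]] by simp
  then show ?thesis
    using assms(1) filterlim_compose unfolding cont_seminorm_def by blast
qed

lemma tendsto_seq_seminorm: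
  fixes l :: "'a::locally_convex_t2_space"
  assumes "seq_seminorm p" "f \<longlonglongrightarrow> l"
  shows "(\<lambda>i. p (f i - l)) \<longlonglongrightarrow> 0"
proof -
  have "(\<lambda>i. f i - l) \<longlonglongrightarrow> 0"
    using tendsto_diff[OF assms(2) tendsto_const[of l]] by simp
  then show ?thesis
    using assms(1) unfolding seq_seminorm_def by blast
qed

lemma tendsto_seminormI:
  fixes l :: "'a::locally_convex_t2_space"
  assumes "\<And>p. cont_seminorm p \<Longrightarrow> ((\<lambda>i. p (f i - l)) \<longlongrightarrow> 0) F"
  shows "(f \<longlongrightarrow> l) F"
proof (rule topological_tendstoI)
  fix S :: "'a set" assume S: "open S" "l \<in> S"
  have "((\<lambda>u. u + l) \<longlongrightarrow> 0 + l) (nhds 0)"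
    by (intro tendsto_add tendsto_const) (simp add: filterlim_ident)
  then have "eventually (\<lambda>u. u + l \<in> S) (nhds 0)"
    using S by (auto dest: topological_tendstoD)
  then obtain U where U: "open U" "0 \<in> U" "\<And>u. u \<in> U \<Longrightarrow> u + l \<in> S"
    unfolding eventually_nhds by blast
  obtain p where p: "cont_seminorm p" "\<And>x. p x < 1 \<Longrightarrow> x \<in> U"
    using exists_cont_seminorm[OF U(1,2)] by blast
  have "eventually (\<lambda>i. p (f i - l) < 1) F"
    using order_tendstoD(2)[OF assms[OF p(1)], of 1] by simp
  then show "eventually (\<lambda>i. f i \<in> S) F"
  proof eventually_elim
    case (elim i)
    then show ?case using U(3)[OF p(2)] by force
  qed
qed

lemma tendsto_seminorm_leI:
  fixes l :: "'a::locally_convex_t2_space"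
  assumes "\<And>p. cont_seminorm p \<Longrightarrow>
    \<exists>g. eventually (\<lambda>i. p (f i - l) \<le> g i) F \<and> (g \<longlongrightarrow> 0) F"
  shows "(f \<longlongrightarrow> l) F"
proof (rule tendsto_seminormI)
  fix p :: "'a \<Rightarrow> real" assume p: "cont_seminorm p"
  obtain g where g: "eventually (\<lambda>i. p (f i - l) \<le> g i) F" "(g \<longlongrightarrow> 0) F"
    using assms[OF p] by blast
  show "((\<lambda>i. p (f i - l)) \<longlongrightarrow> 0) F"
    by (rule tendsto_sandwich[OF _ g(1) tendsto_const g(2)])
       (simp add: seminorm_nonneg[OF cont_seminorm_imp_seminorm[OF p]])
qed

text \<open>Limits of Riemann sums and of iterates are estimated in this form, with \<open>q\<close> one of the suprema
  above and the bound \<open>g\<close> possibly varying along the sequence.\<close>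

lemma seq_seminorm_le_limit:
  fixes l :: "'a::locally_convex_t2_space"
  assumes q: "seq_seminorm q" and lim: "f \<longlonglongrightarrow> l" and le: "eventually (\<lambda>n. q (f n) \<le> g n) sequentially"
    and g: "g \<longlonglongrightarrow> c"
  shows "q l \<le> c"
proof -
  have s: "seminorm q" using q by (simp add: seq_seminorm_def)
  have "eventually (\<lambda>n. q l \<le> g n + q (f n - l)) sequentially"
    using le
  proof eventually_elim
    case (elim n)
    then show ?case
      using seminorm_le_diff[OF s, of l "f n"] seminorm_diff_commute[OF s, of l "f n"] by simp
  qed
  moreover have "(\<lambda>n. g n + q (f n - l)) \<longlonglongrightarrow> c + 0"
    by (intro tendsto_add g tendsto_seq_seminorm q lim)
  ultimately have "q l \<le> c + 0"
    by (intro tendsto_lowerbound) auto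
  then show ?thesis by simp
qed

lemma tvs_CauchyI:
  fixes xs :: "nat \<Rightarrow> 'a::locally_convex_t2_space"
  assumes "\<And>p e. cont_seminorm p \<Longrightarrow> e > 0 \<Longrightarrow> \<exists>N. \<forall>n\<ge>N. \<forall>m\<ge>N. p (xs n - xs m) < e"
  shows "tvs_Cauchy xs"
  unfolding tvs_Cauchy_def
proof (intro allI impI, elim conjE)
  fix U :: "'a set" assume "open U" "0 \<in> U"
  then obtain p where p: "cont_seminorm p" "\<And>x. p x < 1 \<Longrightarrow> x \<in> U"
    using exists_cont_seminorm by blast
  show "\<exists>N. \<forall>n\<ge>N. \<forall>m\<ge>N. xs n - xs m \<in> U"
    using assms[OF p(1), of 1] p(2) by fastforce
qed

section \<open>Sequential equicontinuity of families of linear operators\<close>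

definition sup_seminorm :: "'i set \<Rightarrow> ('i \<Rightarrow> 'a \<Rightarrow> 'b) \<Rightarrow> ('b \<Rightarrow> real) \<Rightarrow> 'a \<Rightarrow> real" where
  "sup_seminorm I f p x = (SUP i\<in>I. p (f i x))"

lemma seq_equicontinuousD:
  fixes f :: "'i \<Rightarrow> 'a \<Rightarrow> 'a::locally_convex_t2_space"
  assumes f: "seq_equicontinuous I f" and p: "cont_seminorm p" and xs: "xs \<longlonglongrightarrow> x" and e: "e > 0"
  shows "\<exists>N. \<forall>i\<in>I. \<forall>n\<ge>N. p (f i (xs n) - f i x) < e"
proof -
  have "eventually (\<lambda>u. p u < e) (nhds 0)"
    using p e by (intro order_tendstoD) (auto simp: cont_seminorm_def)
  then obtain U where U: "open U" "0 \<in> U" "\<And>u. u \<in> U \<Longrightarrow> p u < e"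
    unfolding eventually_nhds by blast
  then show ?thesis
    using f xs unfolding seq_equicontinuous_def by meson
qed

text \<open>The sequence \<open>x / n\<close> tends to \<open>0\<close>, so some \<open>n\<close> satisfies \<open>p (f i (x / n)) < 1\<close> for all
  \<open>i\<close> simultaneously. Hence the supremum defining \<^const>\<open>sup_seminorm\<close> is finite.\<close>

lemma bdd_above_seq_equicontinuous:
  fixes f :: "'i \<Rightarrow> 'a \<Rightarrow> 'a::locally_convex_t2_space"
  assumes f: "seq_equicontinuous I f" "\<And>i. i \<in> I \<Longrightarrow> linear (f i)" and p: "cont_seminorm p"
  shows "bdd_above ((\<lambda>i. p (f i x)) ` I)"
proof -
  note s = cont_seminorm_imp_seminorm[OF p]
  have "(\<lambda>n. (1 / real (Suc n)) *\<^sub>R x) \<longlonglongrightarrow> 0 *\<^sub>R x"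
    by (intro tendsto_scaleR_lc tendsto_const) (rule LIMSEQ_Suc[OF lim_1_over_n])
  then obtain N where N: "\<forall>i\<in>I. \<forall>n\<ge>N. p (f i ((1 / real (Suc n)) *\<^sub>R x) - f i (0 *\<^sub>R x)) < 1"
    using seq_equicontinuousD[OF f(1) p, of _ _ 1] by fastforce
  have "p (f i x) \<le> real (Suc N)" if "i \<in> I" for i
  proof -
    have "p ((1 / real (Suc N)) *\<^sub>R f i x) < 1"
      using N that linear_0[OF f(2)[OF that]] linear_scale[OF f(2)[OF that], of "1 / real (Suc N)" x]
      by force
    then show ?thesis
      by (simp add: seminorm_scaleR[OF s] field_simps)
  qed
  then show ?thesis by (intro bdd_aboveI2)
qed

lemma sup_seminorm_upper:
  fixes f :: "'i \<Rightarrow> 'a \<Rightarrow> 'a::locally_convex_t2_space"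
  assumes f: "seq_equicontinuous I f" "\<And>i. i \<in> I \<Longrightarrow> linear (f i)" and p: "cont_seminorm p"
    and i: "i \<in> I"
  shows "p (f i x) \<le> sup_seminorm I f p x"
  unfolding sup_seminorm_def
  by (rule cSUP_upper[OF i bdd_above_seq_equicontinuous]) (use assms in auto)

lemma seq_seminorm_sup_seminorm:
  fixes f :: "'i \<Rightarrow> 'a \<Rightarrow> 'a::locally_convex_t2_space"
  assumes f: "seq_equicontinuous I f" "\<And>i. i \<in> I \<Longrightarrow> linear (f i)" and p: "cont_seminorm p"
    and ne: "I \<noteq> {}"
  shows "seq_seminorm (sup_seminorm I f p)"
proof -
  note s = cont_seminorm_imp_seminorm[OF p]
  let ?q = "sup_seminorm I f p"
  have upper: "p (f i x) \<le> ?q x" if "i \<in> I" for i x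
    by (rule sup_seminorm_upper[OF f p that])
  have least: "?q x \<le> c" if "\<And>i. i \<in> I \<Longrightarrow> p (f i x) \<le> c" for c x
    unfolding sup_seminorm_def using that by (intro cSUP_least ne)
  have nonneg: "0 \<le> ?q x" for x
    using ne upper seminorm_nonneg[OF s] order_trans by blast
  have "?q (x + y) \<le> ?q x + ?q y" for x y
  proof (rule least)
    fix i assume i: "i \<in> I"
    show "p (f i (x + y)) \<le> ?q x + ?q y"
      using seminorm_add[OF s, of "f i x" "f i y"] upper[OF i, of x] upper[OF i, of y]
        linear_add[OF f(2)[OF i], of x y] by simp
  qed
  moreover have "?q (c *\<^sub>R x) = \<bar>c\<bar> * ?q x" for c x
  proof -
    have le: "?q (c *\<^sub>R x) \<le> \<bar>c\<bar> * ?q x" for c x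
    proof (rule least)
      fix i assume i: "i \<in> I"
      show "p (f i (c *\<^sub>R x)) \<le> \<bar>c\<bar> * ?q x"
        using upper[OF i, of x] linear_scale[OF f(2)[OF i], of c x] seminorm_scaleR[OF s, of c "f i x"]
        by (simp add: mult_left_mono)
    qed
    show ?thesis
    proof (cases "c = 0")
      case True
      then show ?thesis using le[of 0 x] nonneg[of "0 *\<^sub>R x"] by simp
    next
      case False
      then show ?thesis using le[of c x] le[of "1 / c" "c *\<^sub>R x"] by (simp add: field_simps)
    qed
  qed
  ultimately have "seminorm ?q" by (simp add: seminorm_def)
  moreover have "(\<lambda>n. ?q (xs n)) \<longlonglongrightarrow> 0" if xs: "xs \<longlonglongrightarrow> 0" for xs
  proof (rule LIMSEQ_I)
    fix e :: real assume e: "e > 0"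
    then obtain N where N: "\<forall>i\<in>I. \<forall>n\<ge>N. p (f i (xs n) - f i 0) < e / 2"
      using seq_equicontinuousD[OF f(1) p xs, of "e / 2"] by auto
    have "?q (xs n) \<le> e / 2" if "n \<ge> N" for n
    proof (rule least)
      fix i assume "i \<in> I"
      then show "p (f i (xs n)) \<le> e / 2"
        using N that linear_0[OF f(2)] by force
    qed
    then have "\<forall>n\<ge>N. norm (?q (xs n) - 0) < e"
      using e nonneg by (fastforce simp: abs_of_nonneg)
    then show "\<exists>N. \<forall>n\<ge>N. norm (?q (xs n) - 0) < e" by blast
  qed
  ultimately show ?thesis unfolding seq_seminorm_def by blast
qed

lemma seq_equicontinuousI:
  fixes f :: "'i \<Rightarrow> 'a \<Rightarrow> 'a::locally_convex_t2_space"
  assumes lin: "\<And>i. i \<in> I \<Longrightarrow> linear (f i)"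
    and dom: "\<And>p. cont_seminorm p \<Longrightarrow> \<exists>q. seq_seminorm q \<and> (\<forall>i\<in>I. \<forall>x. p (f i x) \<le> q x)"
  shows "seq_equicontinuous I f"
  unfolding seq_equicontinuous_def
proof (intro allI impI, elim conjE)
  fix x :: 'a and xs and U :: "'a set"
  assume xs: "xs \<longlonglongrightarrow> x" and "open U" "0 \<in> U"
  then obtain p where p: "cont_seminorm p" "\<And>x. p x < 1 \<Longrightarrow> x \<in> U"
    using exists_cont_seminorm by blast
  obtain q where q: "seq_seminorm q" "\<And>i x. i \<in> I \<Longrightarrow> p (f i x) \<le> q x"
    using dom[OF p(1)] by blast
  have "eventually (\<lambda>n. q (xs n - x) < 1) sequentially"
    using order_tendstoD(2)[OF tendsto_seq_seminorm[OF q(1) xs], of 1] by simp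
  then obtain N where "\<And>n. n \<ge> N \<Longrightarrow> q (xs n - x) < 1"
    by (auto simp: eventually_sequentially)
  then have "\<forall>i\<in>I. \<forall>n\<ge>N. f i (xs n) - f i x \<in> U"
    using q(2) p(2) linear_diff[OF lin] by (metis order_le_less_trans)
  then show "\<exists>N. \<forall>i\<in>I. \<forall>n\<ge>N. f i (xs n) - f i x \<in> U" by blast
qed

lemma equicontinuous_reindex:
  assumes "seq_equicontinuous I f" "g ` K \<subseteq> I"
  shows "seq_equicontinuous K (\<lambda>k. f (g k))"
  using assms unfolding seq_equicontinuous_def by (meson image_subset_iff)

section \<open>Riemann sums and Riemann integrals\<close>

definition tagged_sum :: "(real \<Rightarrow> 'a::real_vector) \<Rightarrow> (real \<times> real set) set \<Rightarrow> 'a" where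
  "tagged_sum f P = (\<Sum>(t, k)\<in>P. measure lborel k *\<^sub>R f t)"

definition mesh_less :: "(real \<times> real set) set \<Rightarrow> real \<Rightarrow> bool" where
  "mesh_less P \<delta> \<longleftrightarrow> (\<forall>(t, k)\<in>P. measure lborel k < \<delta>)"

lemma mesh_lessD: "mesh_less P \<delta> \<Longrightarrow> (t, k) \<in> P \<Longrightarrow> measure lborel k < \<delta>"
  by (auto simp: mesh_less_def)

lemma has_riemann_integral_iff:
  "has_riemann_integral f J a b \<longleftrightarrow>
    (\<forall>U. open U \<and> 0 \<in> U \<longrightarrow>
      (\<exists>\<delta>>0. \<forall>P. P tagged_division_of {a..b} \<and> mesh_less P \<delta> \<longrightarrow> tagged_sum f P - J \<in> U))"
  unfolding has_riemann_integral_def tagged_sum_def mesh_less_def ..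

text \<open>The tags are the right endpoints: for a decreasing weight such as \<open>exp (- l * t)\<close> these sums lie
  below the integral of the weight, and all tags of a sum over \<open>[0, h]\<close> are positive times.\<close>

definition riemann_sum :: "(real \<Rightarrow> 'a::real_vector) \<Rightarrow> real \<Rightarrow> real \<Rightarrow> nat \<Rightarrow> 'a" where
  "riemann_sum f a b n = (\<Sum>k<n. ((b - a) / n) *\<^sub>R f (a + real (Suc k) * ((b - a) / n)))"

definition uniform_tagging :: "real \<Rightarrow> real \<Rightarrow> nat \<Rightarrow> (real \<times> real set) set" where
  "uniform_tagging a h n =
    (\<lambda>k. (a + real (Suc k) * h, {a + real k * h..a + real (Suc k) * h})) ` {..<n}"

lemma uniform_tagging_division:
  assumes "0 \<le> h" "0 < n"
  shows "uniform_tagging a h n tagged_division_of {a..a + real n * h}"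
  using assms(2)
proof (induction n rule: nat_induct_non_zero)
  case 1
  then show ?case
    using assms tagged_division_of_self[of "a + h" a "a + h"] by (simp add: uniform_tagging_def lessThan_Suc)
next
  case (Suc n)
  let ?I = "{a + real n * h..a + real (Suc n) * h}"
  have "{(a + real (Suc n) * h, ?I)} tagged_division_of ?I"
    using assms tagged_division_of_self[of "a + real (Suc n) * h" "a + real n * h" "a + real (Suc n) * h"]
    by (simp add: algebra_simps)
  moreover have "interior {a..a + real n * h} \<inter> interior ?I = {}"
    by (auto simp: interior_atLeastAtMost_real)
  ultimately have "(uniform_tagging a h n \<union> {(a + real (Suc n) * h, ?I)})
      tagged_division_of ({a..a + real n * h} \<union> ?I)"
    by (rule tagged_division_Un[OF Suc.IH])
  moreover have "{a..a + real n * h} \<union> ?I = {a..a + real (Suc n) * h}"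
    using assms by (intro ivl_disj_un_two_touch) (auto simp: algebra_simps)
  moreover have "uniform_tagging a h n \<union> {(a + real (Suc n) * h, ?I)} = uniform_tagging a h (Suc n)"
    by (simp add: uniform_tagging_def lessThan_Suc)
  ultimately show ?case by simp
qed

lemma uniform_tagging_mesh:
  "0 \<le> h \<Longrightarrow> (t, k) \<in> uniform_tagging a h n \<Longrightarrow> measure lborel k = h"
  by (auto simp: uniform_tagging_def algebra_simps)

text \<open>If \<open>a = b\<close> then all \<open>n\<close> tagged intervals coincide, but both sides are zero.\<close>

lemma tagged_sum_uniform_tagging:
  assumes "a \<le> b"
  shows "tagged_sum f (uniform_tagging a ((b - a) / n) n) = riemann_sum f a b n"
proof (cases "a = b \<or> n = 0")
  case True
  have "tagged_sum f (uniform_tagging a 0 n) = 0"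
    unfolding tagged_sum_def by (rule sum.neutral) (use uniform_tagging_mesh[of 0] in auto)
  then show ?thesis
    using True by (auto simp: riemann_sum_def tagged_sum_def uniform_tagging_def)
next
  case False
  define h where "h = (b - a) / n"
  have h: "h > 0" using False assms by (simp add: h_def)
  have "inj_on (\<lambda>k. (a + real (Suc k) * h, {a + real k * h..a + real (Suc k) * h})) {..<n}"
    using h by (auto simp: inj_on_def)
  then have "tagged_sum f (uniform_tagging a h n) = riemann_sum f a b n"
    unfolding tagged_sum_def uniform_tagging_def riemann_sum_def h_def[symmetric]
    using h by (subst sum.reindex) (auto simp: algebra_simps intro!: sum.cong)
  then show ?thesis by (simp add: h_def)
qed

lemma has_riemann_integral_tagged_sum_tendsto:
  assumes f: "has_riemann_integral f J a b"
    and div: "eventually (\<lambda>n. P n tagged_division_of {a..b}) F"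
    and mesh: "eventually (\<lambda>n. \<forall>(t, k)\<in>P n. measure lborel k \<le> \<delta> n) F" "(\<delta> \<longlongrightarrow> 0) F"
  shows "((\<lambda>n. tagged_sum f (P n)) \<longlongrightarrow> J) F"
proof (rule tendsto_seminormI)
  fix p :: "'a \<Rightarrow> real" assume p: "cont_seminorm p"
  show "((\<lambda>n. p (tagged_sum f (P n) - J)) \<longlongrightarrow> 0) F"
  proof (rule order_tendstoI)
    fix e :: real assume "e < 0"
    then show "eventually (\<lambda>n. e < p (tagged_sum f (P n) - J)) F"
      using seminorm_nonneg[OF cont_seminorm_imp_seminorm[OF p]] by (simp add: order_less_le_trans)
  next
    fix e :: real assume e: "0 < e"
    have "eventually (\<lambda>u. p u < e) (nhds 0)"
      using p e by (intro order_tendstoD) (auto simp: cont_seminorm_def)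
    then obtain U where U: "open U" "0 \<in> U" "\<And>u. u \<in> U \<Longrightarrow> p u < e"
      unfolding eventually_nhds by blast
    then have "\<exists>d>0. \<forall>P. P tagged_division_of {a..b} \<and> mesh_less P d \<longrightarrow> tagged_sum f P - J \<in> U"
      using f unfolding has_riemann_integral_iff by simp
    then obtain d where d: "d > 0"
        "\<And>P. P tagged_division_of {a..b} \<Longrightarrow> mesh_less P d \<Longrightarrow> tagged_sum f P - J \<in> U"
      by auto
    have "eventually (\<lambda>n. \<delta> n < d) F"
      using mesh(2) d(1) by (rule order_tendstoD)
    with div mesh(1) show "eventually (\<lambda>n. p (tagged_sum f (P n) - J) < e) F"
    proof eventually_elim
      case (elim n)
      then have "mesh_less (P n) d" by (fastforce simp: mesh_less_def)
      then show ?case using d(2)[of "P n"] elim U(3) by blast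
    qed
  qed
qed

lemma riemann_sum_tendsto:
  assumes f: "has_riemann_integral f J a b" and "a \<le> b"
  shows "riemann_sum f a b \<longlonglongrightarrow> J"
proof -
  have "(\<lambda>n. tagged_sum f (uniform_tagging a ((b - a) / n) n)) \<longlonglongrightarrow> J"
  proof (rule has_riemann_integral_tagged_sum_tendsto[OF f])
    show "eventually (\<lambda>n. uniform_tagging a ((b - a) / n) n tagged_division_of {a..b}) sequentially"
      using eventually_gt_at_top[of 0]
    proof eventually_elim
      case (elim n)
      then show ?case using uniform_tagging_division[of "(b - a) / n" n a] \<open>a \<le> b\<close> by simp
    qed
    show "\<forall>\<^sub>F n in sequentially. \<forall>(t, k)\<in>uniform_tagging a ((b - a) / n) n. measure lborel k \<le> (b - a) / n"
    proof (intro always_eventually allI ballI, clarify)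
      fix n t k assume "(t, k) \<in> uniform_tagging a ((b - a) / n) n"
      then show "measure lborel k \<le> (b - a) / n"
        using uniform_tagging_mesh[of "(b - a) / n" t k a n] \<open>a \<le> b\<close> by simp
    qed
    show "(\<lambda>n. (b - a) / real n) \<longlonglongrightarrow> 0"
      by (rule lim_const_over_n)
  qed
  then show ?thesis using tagged_sum_uniform_tagging[OF \<open>a \<le> b\<close>, of f] by simp
qed

lemma tagged_division_tag_mem: "P tagged_division_of S \<Longrightarrow> (t, k) \<in> P \<Longrightarrow> t \<in> k \<and> k \<subseteq> S"
  by (auto dest: tagged_division_ofD)

text \<open>Glueing a tagging of \<open>[c, a]\<close> to one of \<open>[a, b]\<close> approximates the integral over \<open>[c, b]\<close>. The
  difference of the two integrals thus inherits every estimate that holds for sums over \<open>[a, b]\<close>.\<close>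

lemma riemann_sum_diff_tendsto:
  assumes I: "has_riemann_integral f I c a" and J: "has_riemann_integral f J c b"
    and "c \<le> a" "a \<le> b"
  shows "riemann_sum f a b \<longlonglongrightarrow> J - I"
proof -
  define P where "P n = uniform_tagging c ((a - c) / real n) n" for n
  define Q where "Q n = uniform_tagging a ((b - a) / real n) n" for n
  have P: "P n tagged_division_of {c..a}" and Q: "Q n tagged_division_of {a..b}" if "n > 0" for n
    using uniform_tagging_division[of "(a - c) / n" n c] uniform_tagging_division[of "(b - a) / n" n a] assms that
    by (auto simp: P_def Q_def)
  have "(\<lambda>n. tagged_sum f (P n \<union> Q n)) \<longlonglongrightarrow> J"
  proof (rule has_riemann_integral_tagged_sum_tendsto[OF J])
    show "eventually (\<lambda>n. P n \<union> Q n tagged_division_of {c..b}) sequentially"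
      using eventually_gt_at_top[of 0]
    proof eventually_elim
      case (elim n)
      have "{c..a} \<union> {a..b} = {c..b}" using assms by auto
      then show ?case
        using tagged_division_Un[OF P[OF elim] Q[OF elim]] by (auto simp: interior_atLeastAtMost_real)
    qed
    show "\<forall>\<^sub>F n in sequentially. \<forall>(t, k)\<in>P n \<union> Q n. measure lborel k \<le> (a - c) / n + (b - a) / n"
    proof (intro always_eventually allI ballI, clarify)
      fix n t k assume tk: "(t, k) \<in> P n \<union> Q n"
      have "0 \<le> (a - c) / real n" "0 \<le> (b - a) / real n" using assms by simp_all
      then show "measure lborel k \<le> (a - c) / n + (b - a) / n"
        using tk uniform_tagging_mesh[of "(a - c) / real n" t k c n] uniform_tagging_mesh[of "(b - a) / real n" t k a n]
        unfolding P_def Q_def by auto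
    qed
    show "(\<lambda>n. (a - c) / real n + (b - a) / real n) \<longlonglongrightarrow> 0"
      using tendsto_add[OF lim_const_over_n lim_const_over_n] by simp
  qed
  moreover have "riemann_sum f c a \<longlonglongrightarrow> I"
    by (rule riemann_sum_tendsto) fact+
  ultimately have lim: "(\<lambda>n. tagged_sum f (P n \<union> Q n) - riemann_sum f c a n) \<longlonglongrightarrow> J - I"
    by (rule tendsto_diff)
  have "eventually (\<lambda>n. tagged_sum f (P n \<union> Q n) - riemann_sum f c a n = riemann_sum f a b n) sequentially"
    using eventually_gt_at_top[of 0]
  proof eventually_elim
    case (elim n)
    have "tagged_sum f (P n \<union> Q n) = tagged_sum f (P n) + tagged_sum f (Q n)"
      unfolding tagged_sum_def
    proof (rule sum.union_inter_neutral)
      show "finite (P n)" "finite (Q n)" by (simp_all add: P_def Q_def uniform_tagging_def)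
      \<comment> \<open>a tagged interval can belong to both taggings only if it is \<open>{a}\<close>, of length zero\<close>
      show "\<forall>x\<in>P n \<inter> Q n. (case x of (t, k) \<Rightarrow> measure lborel k *\<^sub>R f t) = 0"
      proof (clarify)
        fix t k assume "(t, k) \<in> P n" "(t, k) \<in> Q n"
        then have "t \<in> k" "k \<subseteq> {c..a}" "k \<subseteq> {a..b}"
          using P[OF elim] Q[OF elim] tagged_division_tag_mem by blast+
        moreover have "{c..a} \<inter> {a..b} = {a}" using assms by auto
        ultimately have "t \<in> k" "k \<subseteq> {a}" using Int_greatest[of k "{c..a}" "{a..b}"] by simp_all
        then have "k = {a}" by blast
        then show "measure lborel k *\<^sub>R f t = 0" by simp
      qed
    qed
    then show ?case
      using tagged_sum_uniform_tagging[OF \<open>c \<le> a\<close>, of f n] tagged_sum_uniform_tagging[OF \<open>a \<le> b\<close>, of f n]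
      by (simp add: P_def Q_def)
  qed
  then show ?thesis using lim by (rule Lim_transform_eventually[rotated])
qed

text \<open>Integrate the indicator function of \<open>[c, d]\<close> over the pieces of the division.\<close>

lemma measure_tagged_division_Int:
  fixes P :: "(real \<times> real set) set"
  assumes P: "P tagged_division_of {a..b}" and "{c..d} \<subseteq> {a..b}"
  shows "measure lborel {c..d} = (\<Sum>(t, k)\<in>P. measure lborel ({c..d} \<inter> k))"
proof -
  let ?f = "\<lambda>x::real. if x \<in> {c..d} then 1 else 0 :: real"
  have int: "integral k ?f = measure lborel ({c..d} \<inter> k)" if "k = {u..v}" for k u v
    unfolding that by (simp only: integral_restrict_Int Int_commute[of _ "{c..d}"] Int_atLeastAtMost)
      (simp add: content_real_if integral_const_real)
  have "?f integrable_on {a..b}"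
    by (simp only: integrable_restrict_Int Int_atLeastAtMost) (simp add: integrable_const_ivl)
  then have "integral {a..b} ?f = (\<Sum>(t, k)\<in>P. integral k ?f)"
    using integral_combine_tagged_division_topdown[of ?f a b P] P by simp
  also have "\<dots> = (\<Sum>(t, k)\<in>P. measure lborel ({c..d} \<inter> k))"
  proof (rule sum.cong, simp, clarify)
    fix t k assume "(t, k) \<in> P"
    then obtain u v where "k = {u..v}"
      using tagged_division_ofD(4)[OF P] by (metis interval_cbox)
    then show "integral k ?f = measure lborel ({c..d} \<inter> k)" by (rule int)
  qed
  finally have "integral {a..b} ?f = (\<Sum>(t, k)\<in>P. measure lborel ({c..d} \<inter> k))" .
  moreover have "{c..d} \<inter> {a..b} = {c..d}"
    using \<open>{c..d} \<subseteq> {a..b}\<close> by (rule Int_absorb2)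
  then have "integral {a..b} ?f = measure lborel {c..d}"
    using int[OF refl, of a b] by (simp only:)
  ultimately show ?thesis by (simp only:)
qed

text \<open>Both sums are rewritten over the common refinement, whose pieces are the intersections \<open>k \<inter> k'\<close>.
  Where such a piece is nonempty, the two tags are less than \<open>d\<close> apart.\<close>

lemma tagged_sums_close:
  assumes p: "seminorm p"
    and P: "P tagged_division_of {a..b}" and Q: "Q tagged_division_of {a..b}" and "a \<le> b"
    and P_mesh: "mesh_less P (d / 2)" and Q_mesh: "mesh_less Q (d / 2)"
    and unif: "\<And>s t. s \<in> {a..b} \<Longrightarrow> t \<in> {a..b} \<Longrightarrow> \<bar>s - t\<bar> < d \<Longrightarrow> p (f s - f t) \<le> e"
  shows "p (tagged_sum f P - tagged_sum f Q) \<le> (b - a) * e"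
proof -
  define w where "w x y = measure lborel (snd x \<inter> snd y)" for x y :: "real \<times> real set"
  have split: "measure lborel (snd x) = sum (w x) R"
    if P: "P tagged_division_of {a..b}" and R: "R tagged_division_of {a..b}" and "x \<in> P" for P R x
  proof -
    obtain u v where uv: "snd x = {u..v}"
      using tagged_division_ofD(4)[OF P, of "fst x" "snd x"] \<open>x \<in> P\<close> by (auto simp: cbox_interval)
    moreover have "snd x \<subseteq> {a..b}"
      using tagged_division_tag_mem[OF P, of "fst x" "snd x"] \<open>x \<in> P\<close> by simp
    ultimately show ?thesis
      using measure_tagged_division_Int[OF R, of u v] by (simp add: w_def case_prod_beta)
  qed
  have PS: "tagged_sum f P = (\<Sum>x\<in>P. \<Sum>y\<in>Q. w x y *\<^sub>R f (fst x))"
    unfolding tagged_sum_def case_prod_beta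
    by (intro sum.cong) (simp_all add: split[OF P Q] scaleR_sum_left)
  have "tagged_sum f Q = (\<Sum>y\<in>Q. \<Sum>x\<in>P. w y x *\<^sub>R f (fst y))"
    unfolding tagged_sum_def case_prod_beta
    by (intro sum.cong) (simp_all add: split[OF Q P] scaleR_sum_left)
  also have "\<dots> = (\<Sum>x\<in>P. \<Sum>y\<in>Q. w x y *\<^sub>R f (fst y))"
    by (subst sum.swap) (simp add: w_def Int_commute)
  finally have "tagged_sum f P - tagged_sum f Q = (\<Sum>x\<in>P. \<Sum>y\<in>Q. w x y *\<^sub>R (f (fst x) - f (fst y)))"
    unfolding PS by (simp add: sum_subtractf scaleR_diff_right)
  also have "p \<dots> \<le> (\<Sum>x\<in>P. \<Sum>y\<in>Q. p (w x y *\<^sub>R (f (fst x) - f (fst y))))"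
    by (intro order_trans[OF seminorm_sum[OF p]] sum_mono seminorm_sum[OF p])
  also have "\<dots> \<le> (\<Sum>x\<in>P. \<Sum>y\<in>Q. w x y * e)"
  proof (intro sum_mono)
    fix x y assume x: "x \<in> P" and y: "y \<in> Q"
    have "w x y * p (f (fst x) - f (fst y)) \<le> w x y * e"
    proof (cases "snd x \<inter> snd y = {}")
      case False
      then obtain z where z: "z \<in> snd x" "z \<in> snd y" by blast
      obtain u v where uv: "snd x = {u..v}"
        using tagged_division_ofD(4)[OF P, of "fst x" "snd x"] x by (auto simp: cbox_interval)
      obtain u' v' where uv': "snd y = {u'..v'}"
        using tagged_division_ofD(4)[OF Q, of "fst y" "snd y"] y by (auto simp: cbox_interval)
      have tags: "fst x \<in> snd x" "snd x \<subseteq> {a..b}" "fst y \<in> snd y" "snd y \<subseteq> {a..b}"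
        using tagged_division_tag_mem[OF P, of "fst x" "snd x"]
          tagged_division_tag_mem[OF Q, of "fst y" "snd y"] x y by simp_all
      moreover have "measure lborel (snd x) < d / 2" "measure lborel (snd y) < d / 2"
        using mesh_lessD[OF P_mesh, of "fst x" "snd x"] mesh_lessD[OF Q_mesh, of "fst y" "snd y"] x y by simp_all
      ultimately have "\<bar>fst x - fst y\<bar> < d"
        using z unfolding uv uv' by (simp add: abs_if split: if_splits)
      then have "p (f (fst x) - f (fst y)) \<le> e"
        using tags by (intro unif) auto
      then show ?thesis by (rule mult_left_mono) (simp add: w_def)
    qed (simp add: w_def)
    then show "p (w x y *\<^sub>R (f (fst x) - f (fst y))) \<le> w x y * e"
      by (simp add: seminorm_scaleR[OF p] w_def)
  qed
  also have "\<dots> = (\<Sum>x\<in>P. measure lborel (snd x)) * e"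
    by (simp add: sum_distrib_right split[OF P Q])
  also have "(\<Sum>x\<in>P. measure lborel (snd x)) = b - a"
    using additive_content_tagged_division[of P a b] P \<open>a \<le> b\<close> by (simp add: case_prod_beta cbox_interval)
  finally show ?thesis .
qed

text \<open>The integral is found as the limit of the uniform Riemann sums; sequential completeness suffices for
  this, and \<open>tagged_sums_close\<close> then compares any other fine tagging with a uniform one.\<close>

lemma riemann_integral_exists:
  fixes f :: "real \<Rightarrow> 'a::locally_convex_t2_space"
  assumes complete: "\<forall>xs :: nat \<Rightarrow> 'a. tvs_Cauchy xs \<longrightarrow> convergent xs" and "a \<le> b"
    and unif: "\<And>p e. cont_seminorm p \<Longrightarrow> e > 0 \<Longrightarrow>
      \<exists>d>0. \<forall>s\<in>{a..b}. \<forall>t\<in>{a..b}. \<bar>s - t\<bar> < d \<longrightarrow> p (f s - f t) \<le> e"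
  shows "\<exists>J. has_riemann_integral f J a b"
proof -
  define P where "P n = uniform_tagging a ((b - a) / n) n" for n
  have P: "P n tagged_division_of {a..b}" if "n > 0" for n
    using uniform_tagging_division[of "(b - a) / n" n a] that \<open>a \<le> b\<close> by (simp add: P_def)
  have close: "\<exists>d>0. \<forall>Q R. Q tagged_division_of {a..b} \<and> R tagged_division_of {a..b} \<and>
      mesh_less Q d \<and> mesh_less R d \<longrightarrow>
      p (tagged_sum f Q - tagged_sum f R) < e" if p: "cont_seminorm p" and e: "e > 0" for p e
  proof -
    define e' where "e' = e / (b - a + 1)"
    have e': "e' > 0" "(b - a) * e' < e"
      using e \<open>a \<le> b\<close> by (auto simp: e'_def field_simps)
    obtain d where d: "d > 0"
        "\<And>s t. s \<in> {a..b} \<Longrightarrow> t \<in> {a..b} \<Longrightarrow> \<bar>s - t\<bar> < d \<Longrightarrow> p (f s - f t) \<le> e'"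
      using unif[OF p e'(1)] by blast
    have "p (tagged_sum f Q - tagged_sum f R) \<le> (b - a) * e'"
      if "Q tagged_division_of {a..b}" "R tagged_division_of {a..b}"
        "mesh_less Q (d / 2)" "mesh_less R (d / 2)" for Q R
      by (rule tagged_sums_close[OF cont_seminorm_imp_seminorm[OF p] that(1,2) \<open>a \<le> b\<close> that(3,4) d(2)])
    then show ?thesis
      using d(1) order_le_less_trans[OF _ e'(2)] by (intro exI[of _ "d / 2"]) simp
  qed
  have mesh: "\<exists>N>0. \<forall>n\<ge>N. mesh_less (P n) d" if "d > 0" for d
  proof -
    have "eventually (\<lambda>n. (b - a) / real n < d) sequentially"
      using order_tendstoD(2)[OF lim_const_over_n that] .
    then obtain N where N: "\<And>n. n \<ge> N \<Longrightarrow> (b - a) / real n < d"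
      by (auto simp: eventually_sequentially)
    have "measure lborel k < d" if "n \<ge> Suc N" "(t, k) \<in> P n" for n t k
      using uniform_tagging_mesh[of "(b - a) / n" t k a n] N[of n] that \<open>a \<le> b\<close> by (simp add: P_def)
    then show ?thesis by (intro exI[of _ "Suc N"]) (auto simp: mesh_less_def)
  qed
  have "tvs_Cauchy (\<lambda>n. tagged_sum f (P n))"
  proof (rule tvs_CauchyI)
    fix p :: "'a \<Rightarrow> real" and e :: real assume p: "cont_seminorm p" and e: "e > 0"
    obtain d where d: "d > 0" "\<And>Q R. Q tagged_division_of {a..b} \<Longrightarrow> R tagged_division_of {a..b} \<Longrightarrow>
        mesh_less Q d \<Longrightarrow> mesh_less R d \<Longrightarrow>
        p (tagged_sum f Q - tagged_sum f R) < e"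
      using close[OF p e] by blast
    obtain N where N: "N > 0" "\<And>n. n \<ge> N \<Longrightarrow> mesh_less (P n) d"
      using mesh[OF d(1)] by blast
    then show "\<exists>N. \<forall>n\<ge>N. \<forall>m\<ge>N. p (tagged_sum f (P n) - tagged_sum f (P m)) < e"
      using d(2) P by (meson order_less_le_trans)
  qed
  then obtain J where J: "(\<lambda>n. tagged_sum f (P n)) \<longlonglongrightarrow> J"
    using complete unfolding convergent_def by blast
  have "has_riemann_integral f J a b"
    unfolding has_riemann_integral_iff
  proof (intro allI impI, elim conjE)
    fix U :: "'a set" assume "open U" "0 \<in> U"
    then obtain p where p: "cont_seminorm p" "\<And>x. p x < 1 \<Longrightarrow> x \<in> U"
      using exists_cont_seminorm by blast
    obtain d where d: "d > 0" "\<And>Q R. Q tagged_division_of {a..b} \<Longrightarrow> R tagged_division_of {a..b} \<Longrightarrow>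
        mesh_less Q d \<Longrightarrow> mesh_less R d \<Longrightarrow>
        p (tagged_sum f Q - tagged_sum f R) < 1 / 2"
      using close[OF p(1), of "1 / 2"] by auto
    obtain N where N: "N > 0" "\<And>n. n \<ge> N \<Longrightarrow> mesh_less (P n) d"
      using mesh[OF d(1)] by blast
    have "eventually (\<lambda>n. p (tagged_sum f (P n) - J) < 1 / 2) sequentially"
      using order_tendstoD(2)[OF tendsto_cont_seminorm[OF p(1) J], of "1 / 2"] by simp
    then obtain n where n: "n \<ge> N" "p (tagged_sum f (P n) - J) < 1 / 2"
      unfolding eventually_sequentially by (meson nle_le)
    have "tagged_sum f Q - J \<in> U" if "Q tagged_division_of {a..b}" "mesh_less Q d" for Q
    proof (rule p(2))
      have "p (tagged_sum f Q - tagged_sum f (P n)) < 1 / 2"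
        using that n N P by (intro d(2)) auto
      then show "p (tagged_sum f Q - J) < 1"
        using n(2) seminorm_triangle[OF cont_seminorm_imp_seminorm[OF p(1)], of "tagged_sum f Q" J "tagged_sum f (P n)"]
        by simp
    qed
    then show "\<exists>\<delta>>0. \<forall>Q. Q tagged_division_of {a..b} \<and> mesh_less Q \<delta> \<longrightarrow>
        tagged_sum f Q - J \<in> U"
      using d(1) by blast
  qed
  then show ?thesis by blast
qed

section \<open>Exponentially weighted Riemann integrals\<close>

text \<open>Each term is at most the integral of \<open>C * exp (- l * t)\<close> over its interval because the
  weight decreases and is evaluated at the right endpoint; these integrals telescope.\<close>

lemma riemann_sum_exp_bound:
  assumes q: "seminorm q" and "l > 0" and "0 \<le> a" "a \<le> b" "n > 0"
    and bound: "\<And>t. t \<ge> 0 \<Longrightarrow> q (g t) \<le> C"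
  shows "q (riemann_sum (\<lambda>t. exp (- l * t) *\<^sub>R g t) a b n) \<le> C * ((exp (- l * a) - exp (- l * b)) / l)"
proof -
  define h where "h = (b - a) / n"
  define E where "E k = exp (- l * (a + real k * h))" for k
  have h: "h \<ge> 0" using assms by (simp add: h_def)
  have C: "C \<ge> 0" using bound[of 0] seminorm_nonneg[OF q, of "g 0"] by simp
  have term_le: "q (h *\<^sub>R (exp (- l * (a + real (Suc k) * h)) *\<^sub>R g (a + real (Suc k) * h)))
      \<le> C / l * (E k - E (Suc k))" for k
  proof -
    have "E k = E (Suc k) * exp (l * h)"
      by (simp add: E_def exp_add[symmetric] algebra_simps)
    then have "l * h * E (Suc k) \<le> E k - E (Suc k)"
      using exp_ge_add_one_self[of "l * h"] mult_left_mono[of "1 + l * h" "exp (l * h)" "E (Suc k)"]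
      by (simp add: algebra_simps E_def)
    then have "h * E (Suc k) \<le> (E k - E (Suc k)) / l"
      using \<open>l > 0\<close> by (simp add: field_simps)
    moreover have "q (g (a + real (Suc k) * h)) \<le> C"
      using h \<open>0 \<le> a\<close> by (intro bound) simp
    ultimately have "h * E (Suc k) * q (g (a + real (Suc k) * h)) \<le> (E k - E (Suc k)) / l * C"
      using h seminorm_nonneg[OF q] by (intro mult_mono) (auto simp: E_def intro: order_trans[rotated])
    then show ?thesis
      using h by (simp add: seminorm_scaleR[OF q] E_def mult.assoc mult.commute)
  qed
  have "q (riemann_sum (\<lambda>t. exp (- l * t) *\<^sub>R g t) a b n) \<le> (\<Sum>k<n. C / l * (E k - E (Suc k)))"
    unfolding riemann_sum_def h_def[symmetric]
    by (intro order_trans[OF seminorm_sum[OF q]] sum_mono term_le)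
  also have "\<dots> = C / l * (E 0 - E n)"
    by (simp only: sum_distrib_left[symmetric] sum_lessThan_telescope')
  also have "a + real n * h = b"
    using \<open>n > 0\<close> by (simp add: h_def)
  then have "E 0 - E n = exp (- l * a) - exp (- l * b)"
    by (simp add: E_def)
  finally show ?thesis by simp
qed

text \<open>A Riemann sum over \<open>[0, h]\<close> divided by \<open>h\<close> is a mean of values of \<open>f\<close> at positive times.\<close>

lemma riemann_sum_average_bound:
  assumes q: "seminorm q" and "h > 0" "n > 0"
    and close: "\<And>t. 0 < t \<Longrightarrow> t \<le> h \<Longrightarrow> q (f t - x) \<le> e"
  shows "q ((1 / h) *\<^sub>R riemann_sum f 0 h n - x) \<le> e"
proof -
  have "(1 / h) *\<^sub>R riemann_sum f 0 h n - x = (\<Sum>k<n. (1 / n) *\<^sub>R (f (real (Suc k) * (h / n)) - x))"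
    using assms by (simp add: riemann_sum_def scaleR_sum_right scaleR_diff_right sum_subtractf sum_constant_scaleR)
  also have "q \<dots> \<le> (\<Sum>k<n. (1 / n) * e)"
  proof (intro order_trans[OF seminorm_sum[OF q]] sum_mono)
    fix k assume "k \<in> {..<n}"
    then have "real (Suc k) \<le> real n" by simp
    then have "real (Suc k) * h \<le> real n * h" using \<open>h > 0\<close> by (intro mult_right_mono) simp_all
    then have "real (Suc k) * (h / n) \<le> h"
      using assms by (simp add: field_simps)
    moreover have "0 < real (Suc k) * (h / n)" using assms by simp
    ultimately show "q ((1 / n) *\<^sub>R (f (real (Suc k) * (h / n)) - x)) \<le> (1 / n) * e"
      using close[of "real (Suc k) * (h / n)"] by (simp add: seminorm_scaleR[OF q] divide_right_mono)
  qed
  also have "\<dots> = e" using \<open>n > 0\<close> by simp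
  finally show ?thesis .
qed

text \<open>The integral over \<open>[a, b]\<close> is bounded by a multiple of \<open>exp (- l * a)\<close>, uniformly in \<open>b\<close>. So the
  integrals over \<open>[0, n]\<close> form a Cauchy sequence, and the same bound passes from integer to real
  endpoints.\<close>

lemma improper_riemann_integral_exp_exists:
  fixes g :: "real \<Rightarrow> 'a::locally_convex_t2_space"
  assumes complete: "\<forall>xs :: nat \<Rightarrow> 'a. tvs_Cauchy xs \<longrightarrow> convergent xs" and l: "l > 0"
    and int: "\<And>a. a \<ge> 0 \<Longrightarrow> \<exists>J. has_riemann_integral (\<lambda>t. exp (- l * t) *\<^sub>R g t) J 0 a"
    and bounded: "\<And>p. cont_seminorm p \<Longrightarrow> \<exists>C. \<forall>t\<ge>0. p (g t) \<le> C"
  shows "improper_riemann_integral_exists (\<lambda>t. exp (- l * t) *\<^sub>R g t)"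
proof -
  let ?f = "\<lambda>t. exp (- l * t) *\<^sub>R g t"
  obtain J where J: "\<And>a. a \<ge> 0 \<Longrightarrow> has_riemann_integral ?f (J a) 0 a"
    using int by metis
  have tail: "\<exists>B. (B \<longlongrightarrow> 0) at_top \<and> (\<forall>a b. 0 \<le> a \<longrightarrow> a \<le> b \<longrightarrow> p (J b - J a) \<le> B a)"
    if p: "cont_seminorm p" for p
  proof -
    obtain C where C: "\<And>t. t \<ge> 0 \<Longrightarrow> p (g t) \<le> C" using bounded[OF p] by blast
    note s = cont_seminorm_imp_seminorm[OF p]
    have C0: "C \<ge> 0" using C[of 0] seminorm_nonneg[OF s, of "g 0"] by simp
    have "p (J b - J a) \<le> C * (exp (- l * a) / l)" if ab: "0 \<le> a" "a \<le> b" for a b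
    proof (rule seq_seminorm_le_limit[OF cont_seminorm_imp_seq_seminorm[OF p] _ _ tendsto_const])
      show "riemann_sum ?f a b \<longlonglongrightarrow> J b - J a"
        by (rule riemann_sum_diff_tendsto[OF J J]) (use ab in auto)
      show "\<forall>\<^sub>F n in sequentially. p (riemann_sum ?f a b n) \<le> C * (exp (- l * a) / l)"
        using eventually_gt_at_top[of 0]
      proof eventually_elim
        case (elim n)
        have "p (riemann_sum ?f a b n) \<le> C * ((exp (- l * a) - exp (- l * b)) / l)"
          by (rule riemann_sum_exp_bound[OF s l ab elim C])
        also have "\<dots> \<le> C * (exp (- l * a) / l)"
          using C0 l by (intro mult_left_mono divide_right_mono) auto
        finally show ?case .
      qed
    qed
    moreover have "((\<lambda>a. C * (exp (- l * a) / l)) \<longlongrightarrow> 0) at_top"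
    proof -
      have "filterlim (\<lambda>a. - l * a) at_bot at_top"
        using l by (intro filterlim_tendsto_neg_mult_at_bot[OF tendsto_const]) (auto simp: filterlim_ident)
      then have "((\<lambda>a. exp (- l * a)) \<longlongrightarrow> 0) at_top"
        by (rule filterlim_compose[OF exp_at_bot])
      then show ?thesis
        using tendsto_mult[OF tendsto_const tendsto_divide[OF _ tendsto_const], of _ 0 at_top l C] l by simp
    qed
    ultimately show ?thesis by (intro exI[of _ "\<lambda>a. C * (exp (- l * a) / l)"]) blast
  qed
  have "tvs_Cauchy (\<lambda>n. J (real n))"
  proof (rule tvs_CauchyI)
    fix p :: "'a \<Rightarrow> real" and e :: real assume p: "cont_seminorm p" and e: "e > 0"
    note s = cont_seminorm_imp_seminorm[OF p]
    obtain B where B: "(B \<longlongrightarrow> 0) at_top" "\<And>a b. 0 \<le> a \<Longrightarrow> a \<le> b \<Longrightarrow> p (J b - J a) \<le> B a"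
      using tail[OF p] by blast
    have "eventually (\<lambda>n. B (real n) < e / 2) sequentially"
      using order_tendstoD(2)[OF filterlim_compose[OF B(1) filterlim_real_sequentially], of "e / 2"] e by simp
    then obtain N where "B (real N) < e / 2" by (auto simp: eventually_sequentially)
    then have N: "p (J (real n) - J (real N)) < e / 2" if "n \<ge> N" for n
      using B(2)[of "real N" "real n"] that by simp
    have "p (J (real n) - J (real m)) < e" if "n \<ge> N" "m \<ge> N" for n m
      using seminorm_triangle[OF s, of "J (real n)" "J (real m)" "J (real N)"] N[OF that(1)] N[OF that(2)]
        seminorm_diff_commute[OF s, of "J (real N)" "J (real m)"] by simp
    then show "\<exists>N. \<forall>n\<ge>N. \<forall>m\<ge>N. p (J (real n) - J (real m)) < e" by blast
  qed
  then obtain r where r: "(\<lambda>n. J (real n)) \<longlonglongrightarrow> r"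
    using complete unfolding convergent_def by blast
  have "(J \<longlongrightarrow> r) at_top"
  proof (rule tendsto_seminorm_leI)
    fix p :: "'a \<Rightarrow> real" assume p: "cont_seminorm p"
    note s = cont_seminorm_imp_seminorm[OF p]
    obtain B where B: "(B \<longlongrightarrow> 0) at_top" "\<And>a b. 0 \<le> a \<Longrightarrow> a \<le> b \<Longrightarrow> p (J b - J a) \<le> B a"
      using tail[OF p] by blast
    have "p (J a - r) \<le> B a" if "a \<ge> 0" for a
    proof (rule seq_seminorm_le_limit[OF cont_seminorm_imp_seq_seminorm[OF p] _ _ tendsto_const])
      show "(\<lambda>n. J a - J (real n)) \<longlonglongrightarrow> J a - r" by (intro tendsto_diff tendsto_const r)
      have "eventually (\<lambda>n. a \<le> real n) sequentially"
        using filterlim_real_sequentially by (simp add: filterlim_at_top)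
      then show "\<forall>\<^sub>F n in sequentially. p (J a - J (real n)) \<le> B a"
      proof eventually_elim
        case (elim n)
        then show ?case
          using B(2)[OF that elim] seminorm_diff_commute[OF s, of "J a"] by simp
      qed
    qed
    then have "eventually (\<lambda>a. p (J a - r) \<le> B a) at_top"
      by (rule eventually_mono[OF eventually_ge_at_top[of 0]])
    then show "\<exists>B. (\<forall>\<^sub>F a in at_top. p (J a - r) \<le> B a) \<and> (B \<longlongrightarrow> 0) at_top"
      using B(1) by blast
  qed
  then show ?thesis
    unfolding improper_riemann_integral_exists_def using J by blast
qed

section \<open>The Laplace transform of a semigroup is the resolvent of its generator\<close>

lemma linear_riemann_sum:
  "linear S \<Longrightarrow> S (riemann_sum f a b n) = riemann_sum (\<lambda>t. S (f t)) a b n"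
  by (simp add: riemann_sum_def linear_sum linear_scale)

lemma generatorI:
  assumes "((\<lambda>h. (1 / h) *\<^sub>R (T h x - x)) \<longlongrightarrow> y) (at_right 0)"
  shows "x \<in> generator_domain T" "generator T x = y"
  using assms tendsto_Lim[OF trivial_limit_at_right_real assms]
  by (auto simp: generator_domain_def generator_def)

lemma generatorD:
  assumes "x \<in> generator_domain T"
  shows "((\<lambda>h. (1 / h) *\<^sub>R (T h x - x)) \<longlongrightarrow> generator T x) (at_right 0)"
  using assms generatorI(2)[of T x] by (auto simp: generator_domain_def)

lemma linear_funpow:
  fixes f :: "'a::real_vector \<Rightarrow> 'a"
  assumes "linear f" shows "linear (f ^^ n)"
proof (induction n)
  case (Suc n)
  then show ?case using linear_compose[OF Suc assms] by (simp add: o_def)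
qed (simp add: linear_id[unfolded id_def])

lemma filterlim_inverse_Suc_at_right: "filterlim (\<lambda>n. 1 / real (Suc n)) (at_right 0) sequentially"
  unfolding filterlim_at using LIMSEQ_inverse_real_of_nat by (simp add: inverse_eq_divide del: of_nat_Suc)

locale laplace_semigroup =
  fixes T :: "real \<Rightarrow> 'a \<Rightarrow> 'a::locally_convex_t2_space"
  assumes semigroup: "C0_seq_equicontinuous_semigroup T"
    and laplace_integrable:
      "\<And>l x. l > 0 \<Longrightarrow> improper_riemann_integral_exists (\<lambda>t. exp (- l * t) *\<^sub>R T t x)"
begin

lemma linear_T: "t \<ge> 0 \<Longrightarrow> linear (T t)"
  and T_0: "T 0 x = x"
  and T_add: "t \<ge> 0 \<Longrightarrow> s \<ge> 0 \<Longrightarrow> T (t + s) x = T t (T s x)"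
  and T_at_right_0: "((\<lambda>t. T t x) \<longlongrightarrow> x) (at_right 0)"
  and equicontinuous_T: "seq_equicontinuous {0..} T"
  using semigroup unfolding C0_seq_equicontinuous_semigroup_def by auto

abbreviation orbit_sup :: "('a \<Rightarrow> real) \<Rightarrow> 'a \<Rightarrow> real" where
  "orbit_sup p \<equiv> sup_seminorm {0..} T p"

lemma seq_seminorm_orbit_sup: "cont_seminorm p \<Longrightarrow> seq_seminorm (orbit_sup p)"
  by (rule seq_seminorm_sup_seminorm[OF equicontinuous_T]) (auto intro: linear_T)

lemma le_orbit_sup: "cont_seminorm p \<Longrightarrow> t \<ge> 0 \<Longrightarrow> p (T t x) \<le> orbit_sup p x"
  by (rule sup_seminorm_upper[OF equicontinuous_T]) (auto intro: linear_T)

text \<open>The orbit of \<open>T t x\<close> is part of the orbit of \<open>x\<close>.\<close>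

lemma orbit_sup_T:
  assumes "cont_seminorm p" "t \<ge> 0"
  shows "orbit_sup p (T t x) \<le> orbit_sup p x"
  unfolding sup_seminorm_def[of _ _ _ "T t x"]
proof (rule cSUP_least)
  fix s :: real assume "s \<in> {0..}"
  then show "p (T s (T t x)) \<le> orbit_sup p x"
    using le_orbit_sup[OF assms(1), of "s + t" x] assms(2) by (simp add: T_add)
qed simp

lemma T_tendsto:
  assumes "t \<ge> 0" "xs \<longlonglongrightarrow> x"
  shows "(\<lambda>n. T t (xs n)) \<longlonglongrightarrow> T t x"
proof (rule tendsto_seminorm_leI)
  fix p :: "'a \<Rightarrow> real" assume p: "cont_seminorm p"
  have "p (T t (xs n) - T t x) \<le> orbit_sup p (xs n - x)" for n
    using le_orbit_sup[OF p assms(1), of "xs n - x"] linear_diff[OF linear_T[OF assms(1)]] by simp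
  then show "\<exists>g. (\<forall>\<^sub>F n in sequentially. p (T t (xs n) - T t x) \<le> g n) \<and> g \<longlonglongrightarrow> 0"
    using tendsto_seq_seminorm[OF seq_seminorm_orbit_sup[OF p] assms(2)] by (meson always_eventually)
qed

definition discounted :: "real \<Rightarrow> 'a \<Rightarrow> real \<Rightarrow> 'a" where
  "discounted l x t = exp (- l * t) *\<^sub>R T t x"

text \<open>Chosen separately for every \<open>a\<close>; \<open>riemann_sum_tendsto\<close> makes the value unique when \<open>a \<ge> 0\<close>.\<close>

definition partial_laplace :: "real \<Rightarrow> 'a \<Rightarrow> real \<Rightarrow> 'a" where
  "partial_laplace l x a = (SOME J. has_riemann_integral (discounted l x) J 0 a)"

definition laplace :: "real \<Rightarrow> 'a \<Rightarrow> 'a" where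
  "laplace l x = Lim at_top (partial_laplace l x)"

context
  fixes l :: real
  assumes l: "l > 0"
begin

lemma has_riemann_integral_partial_laplace:
  "a \<ge> 0 \<Longrightarrow> has_riemann_integral (discounted l x) (partial_laplace l x a) 0 a"
  using laplace_integrable[OF l, of x] unfolding improper_riemann_integral_exists_def partial_laplace_def
    discounted_def[abs_def]
  by (meson someI)

lemma partial_laplace_tendsto: "(partial_laplace l x \<longlongrightarrow> laplace l x) at_top"
proof -
  obtain J r where J: "\<And>a. a \<ge> 0 \<Longrightarrow> has_riemann_integral (discounted l x) (J a) 0 a"
    and r: "(J \<longlongrightarrow> r) at_top"
    using laplace_integrable[OF l, of x]
    unfolding improper_riemann_integral_exists_def discounted_def[abs_def] by blast
  have "J a = partial_laplace l x a" if "a \<ge> 0" for a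
    using riemann_sum_tendsto[OF J[OF that] that]
      riemann_sum_tendsto[OF has_riemann_integral_partial_laplace[OF that] that]
    by (rule LIMSEQ_unique)
  then have "eventually (\<lambda>a. J a = partial_laplace l x a) at_top"
    by (rule eventually_mono[OF eventually_ge_at_top[of 0]])
  then have "(partial_laplace l x \<longlongrightarrow> r) at_top"
    using r by (rule Lim_transform_eventually[rotated])
  moreover from this have "laplace l x = r"
    unfolding laplace_def by (rule tendsto_Lim[OF trivial_limit_at_top_linorder])
  ultimately show ?thesis by simp
qed

lemma riemann_sum_partial_laplace:
  assumes "0 \<le> a" "a \<le> b"
  shows "riemann_sum (discounted l x) a b \<longlonglongrightarrow> partial_laplace l x b - partial_laplace l x a"
  by (rule riemann_sum_diff_tendsto) (use assms in \<open>auto intro: has_riemann_integral_partial_laplace\<close>)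

lemma partial_laplace_0: "partial_laplace l x 0 = 0"
proof -
  have "riemann_sum (discounted l x) 0 0 = (\<lambda>n. 0)"
    by (simp add: riemann_sum_def fun_eq_iff)
  then show ?thesis
    using riemann_sum_tendsto[OF has_riemann_integral_partial_laplace[of 0 x]] LIMSEQ_unique[OF tendsto_const]
    by fastforce
qed

lemma riemann_sum_0_partial_laplace:
  "0 \<le> a \<Longrightarrow> riemann_sum (discounted l x) 0 a \<longlonglongrightarrow> partial_laplace l x a"
  using riemann_sum_partial_laplace[of 0 a x] by (simp add: partial_laplace_0)

lemma laplace_sequence_tendsto: "(\<lambda>n. partial_laplace l x (real n)) \<longlonglongrightarrow> laplace l x"
  using partial_laplace_tendsto filterlim_real_sequentially by (rule filterlim_compose)

lemma linear_partial_laplace: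
  assumes "0 \<le> a"
  shows "linear (\<lambda>x. partial_laplace l x a)"
proof (rule linearI)
  note lim = riemann_sum_0_partial_laplace[OF assms]
  fix x y :: 'a and c :: real
  have "riemann_sum (discounted l (x + y)) 0 a n
      = riemann_sum (discounted l x) 0 a n + riemann_sum (discounted l y) 0 a n" for n
    unfolding riemann_sum_def sum.distrib[symmetric] using assms
    by (intro sum.cong) (simp_all add: discounted_def linear_add[OF linear_T] scaleR_add_right)
  then have "riemann_sum (discounted l (x + y)) 0 a \<longlonglongrightarrow> partial_laplace l x a + partial_laplace l y a"
    using tendsto_add[OF lim[of x] lim[of y]] by (subst (asm) ext[of _ "riemann_sum (discounted l (x + y)) 0 a"]) simp_all
  then show "partial_laplace l (x + y) a = partial_laplace l x a + partial_laplace l y a"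
    by (rule LIMSEQ_unique[OF lim])
  have "riemann_sum (discounted l (c *\<^sub>R x)) 0 a n = c *\<^sub>R riemann_sum (discounted l x) 0 a n" for n
    unfolding riemann_sum_def scaleR_sum_right using assms
    by (intro sum.cong) (simp_all add: discounted_def linear_scale[OF linear_T])
  then have "riemann_sum (discounted l (c *\<^sub>R x)) 0 a \<longlonglongrightarrow> c *\<^sub>R partial_laplace l x a"
    using tendsto_scaleR_lc[OF tendsto_const lim[of x], of c]
    by (subst (asm) ext[of _ "riemann_sum (discounted l (c *\<^sub>R x)) 0 a"]) simp_all
  then show "partial_laplace l (c *\<^sub>R x) a = c *\<^sub>R partial_laplace l x a"
    by (rule LIMSEQ_unique[OF lim])
qed

lemma linear_laplace: "linear (laplace l)"
proof (rule linearI)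
  note lim = laplace_sequence_tendsto
  fix x y :: 'a and c :: real
  have "(\<lambda>n. partial_laplace l (x + y) (real n)) \<longlonglongrightarrow> laplace l x + laplace l y"
    using tendsto_add[OF lim[of x] lim[of y]] by (simp add: linear_add[OF linear_partial_laplace])
  then show "laplace l (x + y) = laplace l x + laplace l y"
    using lim LIMSEQ_unique by blast
  have "(\<lambda>n. partial_laplace l (c *\<^sub>R x) (real n)) \<longlonglongrightarrow> c *\<^sub>R laplace l x"
    using tendsto_scaleR_lc[OF tendsto_const lim[of x], of c] by (simp add: linear_scale[OF linear_partial_laplace])
  then show "laplace l (c *\<^sub>R x) = c *\<^sub>R laplace l x"
    using lim LIMSEQ_unique by blast
qed

text \<open>The operator \<open>l * laplace l\<close> is a mean of the \<open>T t\<close> with weights \<open>l * exp (- l * t)\<close> of total mass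
  one, and \<open>orbit_sup p\<close> is not increased by any \<open>T t\<close>.\<close>

lemma orbit_sup_laplace:
  assumes p: "cont_seminorm p"
  shows "orbit_sup p (l *\<^sub>R laplace l x) \<le> orbit_sup p x"
proof -
  note q = seq_seminorm_orbit_sup[OF p]
  note s = seq_seminorm_imp_seminorm[OF q]
  have "orbit_sup p (partial_laplace l x a) \<le> orbit_sup p x / l" if "a \<ge> 0" for a
  proof (rule seq_seminorm_le_limit[OF q riemann_sum_0_partial_laplace[OF that] _ tendsto_const])
    show "\<forall>\<^sub>F n in sequentially. orbit_sup p (riemann_sum (discounted l x) 0 a n) \<le> orbit_sup p x / l"
      using eventually_gt_at_top[of 0]
    proof eventually_elim
      case (elim n)
      have "orbit_sup p (riemann_sum (discounted l x) 0 a n) \<le> orbit_sup p x * ((exp (- l * 0) - exp (- l * a)) / l)"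
        unfolding discounted_def[abs_def]
        by (rule riemann_sum_exp_bound[OF s l _ that elim]) (auto intro: orbit_sup_T[OF p])
      also have "\<dots> \<le> orbit_sup p x * (1 / l)"
        using l seminorm_nonneg[OF s] by (intro mult_left_mono divide_right_mono) auto
      finally show ?case by simp
    qed
  qed
  then have "orbit_sup p (laplace l x) \<le> orbit_sup p x / l"
    by (intro seq_seminorm_le_limit[OF q laplace_sequence_tendsto _ tendsto_const]) simp
  then show ?thesis
    using l by (simp add: seminorm_scaleR[OF s] field_simps)
qed

lemma orbit_sup_laplace_power:
  assumes p: "cont_seminorm p"
  shows "orbit_sup p (((\<lambda>x. l *\<^sub>R laplace l x) ^^ m) x) \<le> orbit_sup p x"
  by (induction m) (auto intro: order_trans[OF orbit_sup_laplace[OF p]])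

lemma laplace_tendsto:
  assumes "xs \<longlonglongrightarrow> x"
  shows "(\<lambda>n. laplace l (xs n)) \<longlonglongrightarrow> laplace l x"
proof (rule tendsto_seminorm_leI)
  fix p :: "'a \<Rightarrow> real" assume p: "cont_seminorm p"
  note s = seq_seminorm_imp_seminorm[OF seq_seminorm_orbit_sup[OF p]]
  have "p (laplace l (xs n) - laplace l x) \<le> (1 / l) * orbit_sup p (xs n - x)" for n
  proof -
    have "p (laplace l (xs n) - laplace l x) \<le> orbit_sup p (laplace l (xs n - x))"
      using le_orbit_sup[OF p, of 0 "laplace l (xs n - x)"] by (simp add: T_0 linear_diff[OF linear_laplace])
    also have "\<dots> \<le> (1 / l) * orbit_sup p (xs n - x)"
      using orbit_sup_laplace[OF p, of "xs n - x"] l by (simp add: seminorm_scaleR[OF s] field_simps)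
    finally show ?thesis .
  qed
  moreover have "(\<lambda>n. (1 / l) * orbit_sup p (xs n - x)) \<longlonglongrightarrow> (1 / l) * 0"
    by (intro tendsto_intros tendsto_seq_seminorm seq_seminorm_orbit_sup p assms)
  ultimately show "\<exists>g. (\<forall>\<^sub>F n in sequentially. p (laplace l (xs n) - laplace l x) \<le> g n) \<and> g \<longlonglongrightarrow> 0"
    by (intro exI[of _ "\<lambda>n. (1 / l) * orbit_sup p (xs n - x)"]) simp
qed

text \<open>Applying \<open>T h\<close> shifts the integrand by \<open>h\<close>, so that the integral starts at \<open>h\<close> instead
  of \<open>0\<close>, and the discount factor changes by \<open>exp (l * h)\<close>.\<close>

lemma T_laplace:
  assumes h: "h \<ge> 0"
  shows "T h (laplace l x) = exp (l * h) *\<^sub>R (laplace l x - partial_laplace l x h)"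
proof -
  have "T h (partial_laplace l x a) = exp (l * h) *\<^sub>R (partial_laplace l x (a + h) - partial_laplace l x h)"
    if a: "a \<ge> 0" for a
  proof -
    have "T h (riemann_sum (discounted l x) 0 a n) = exp (l * h) *\<^sub>R riemann_sum (discounted l x) h (a + h) n" for n
      unfolding linear_riemann_sum[OF linear_T[OF h]] unfolding riemann_sum_def scaleR_sum_right
    proof (intro sum.cong refl)
      fix k
      let ?t = "real (Suc k) * (a / real n)"
      have "T h (discounted l x ?t) = exp (l * h) *\<^sub>R discounted l x (h + ?t)"
        using h a by (simp add: discounted_def linear_scale[OF linear_T] T_add exp_add[symmetric] algebra_simps del: of_nat_Suc)
      then show "((a - 0) / n) *\<^sub>R T h (discounted l x (0 + real (Suc k) * ((a - 0) / n))) =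
          exp (l * h) *\<^sub>R ((a + h - h) / n) *\<^sub>R discounted l x (h + real (Suc k) * ((a + h - h) / n))"
        by simp
    qed
    then have "(\<lambda>n. T h (riemann_sum (discounted l x) 0 a n))
        \<longlonglongrightarrow> exp (l * h) *\<^sub>R (partial_laplace l x (a + h) - partial_laplace l x h)"
      using tendsto_scaleR_lc[OF tendsto_const riemann_sum_partial_laplace[of h "a + h" x], of "exp (l * h)"] h a
      by simp
    then show ?thesis
      using T_tendsto[OF h riemann_sum_0_partial_laplace[OF a]] LIMSEQ_unique by blast
  qed
  then have "(\<lambda>n. T h (partial_laplace l x (real n)))
      = (\<lambda>n. exp (l * h) *\<^sub>R (partial_laplace l x (real n + h) - partial_laplace l x h))"
    by simp
  moreover have "filterlim (\<lambda>n. real n + h) at_top sequentially"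
    using filterlim_tendsto_add_at_top[OF tendsto_const filterlim_real_sequentially, of h]
    by (simp add: add.commute)
  then have "(\<lambda>n. exp (l * h) *\<^sub>R (partial_laplace l x (real n + h) - partial_laplace l x h))
      \<longlonglongrightarrow> exp (l * h) *\<^sub>R (laplace l x - partial_laplace l x h)"
    by (intro tendsto_scaleR_lc tendsto_diff tendsto_const filterlim_compose[OF partial_laplace_tendsto])
  moreover have "(\<lambda>n. T h (partial_laplace l x (real n))) \<longlonglongrightarrow> T h (laplace l x)"
    by (intro T_tendsto h laplace_sequence_tendsto)
  ultimately show ?thesis using LIMSEQ_unique by metis
qed

lemma laplace_T:
  assumes h: "h \<ge> 0"
  shows "laplace l (T h x) = T h (laplace l x)"
proof -
  have "partial_laplace l (T h x) a = T h (partial_laplace l x a)" if a: "a \<ge> 0" for a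
  proof -
    have "T h (riemann_sum (discounted l x) 0 a n) = riemann_sum (discounted l (T h x)) 0 a n" for n
      unfolding linear_riemann_sum[OF linear_T[OF h]] unfolding riemann_sum_def using h a
      by (intro sum.cong refl)
         (simp add: discounted_def linear_scale[OF linear_T] T_add[symmetric] add.commute del: of_nat_Suc)
    then have "riemann_sum (discounted l (T h x)) 0 a \<longlonglongrightarrow> T h (partial_laplace l x a)"
      using T_tendsto[OF h riemann_sum_0_partial_laplace[OF a, of x]] by simp
    then show ?thesis
      by (rule LIMSEQ_unique[OF riemann_sum_0_partial_laplace[OF a]])
  qed
  then have "(\<lambda>n. partial_laplace l (T h x) (real n)) \<longlonglongrightarrow> T h (laplace l x)"
    using T_tendsto[OF h laplace_sequence_tendsto] by simp
  then show ?thesis using laplace_sequence_tendsto LIMSEQ_unique by blast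
qed

lemma partial_laplace_average_tendsto:
  "((\<lambda>h. (1 / h) *\<^sub>R partial_laplace l x h) \<longlongrightarrow> x) (at_right 0)"
proof (rule tendsto_seminormI)
  fix p :: "'a \<Rightarrow> real" assume p: "cont_seminorm p"
  note s = cont_seminorm_imp_seminorm[OF p]
  have "((\<lambda>t. exp (- l * t) *\<^sub>R T t x) \<longlongrightarrow> exp (- l * 0) *\<^sub>R x) (at_right 0)"
    by (intro tendsto_scaleR_lc T_at_right_0 tendsto_intros)
  then have "((\<lambda>t. p (discounted l x t - x)) \<longlongrightarrow> 0) (at_right 0)"
    using tendsto_cont_seminorm[OF p] by (simp add: discounted_def)
  note lim = this
  show "((\<lambda>h. p ((1 / h) *\<^sub>R partial_laplace l x h - x)) \<longlongrightarrow> 0) (at_right 0)"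
  proof (rule tendstoI)
    fix e :: real assume e: "e > 0"
    have "eventually (\<lambda>t. p (discounted l x t - x) < e / 2) (at_right 0)"
      using lim e by (intro order_tendstoD) auto
    then obtain d where d: "d > 0" "\<And>t. 0 < t \<Longrightarrow> t < d \<Longrightarrow> p (discounted l x t - x) < e / 2"
      by (auto simp: eventually_at_right_field)
    have "p ((1 / h) *\<^sub>R partial_laplace l x h - x) \<le> e / 2" if h: "0 < h" "h < d" for h
    proof (rule seq_seminorm_le_limit[OF cont_seminorm_imp_seq_seminorm[OF p] _ _ tendsto_const])
      show "(\<lambda>n. (1 / h) *\<^sub>R riemann_sum (discounted l x) 0 h n - x) \<longlonglongrightarrow> (1 / h) *\<^sub>R partial_laplace l x h - x"
        using h by (intro tendsto_diff tendsto_scaleR_lc tendsto_const riemann_sum_0_partial_laplace) simp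
      show "\<forall>\<^sub>F n in sequentially. p ((1 / h) *\<^sub>R riemann_sum (discounted l x) 0 h n - x) \<le> e / 2"
        using eventually_gt_at_top[of 0]
      proof eventually_elim
        case (elim n)
        have "p (discounted l x t - x) \<le> e / 2" if "0 < t" "t \<le> h" for t
          using d(2)[of t] that h by simp
        then show ?case by (rule riemann_sum_average_bound[OF s h(1) elim])
      qed
    qed
    then have "\<forall>h. 0 < h \<and> h < d \<longrightarrow> dist (p ((1 / h) *\<^sub>R partial_laplace l x h - x)) 0 < e"
      using e seminorm_nonneg[OF s] by (fastforce simp: abs_of_nonneg)
    then show "\<forall>\<^sub>F h in at_right 0. dist (p ((1 / h) *\<^sub>R partial_laplace l x h - x)) 0 < e"
      using d(1) by (auto simp: eventually_at_right_field)
  qed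
qed

text \<open>By \<open>T_laplace\<close> the difference quotient is
  \<open>(exp (l * h) - 1) / h * laplace l x\<close> minus \<open>exp (l * h)\<close> times the average of
  \<open>partial_laplace_average_tendsto\<close>.\<close>

lemma laplace_difference_quotient_tendsto:
  "((\<lambda>h. (1 / h) *\<^sub>R (T h (laplace l x) - laplace l x)) \<longlongrightarrow> l *\<^sub>R laplace l x - x) (at_right 0)"
proof -
  have "((\<lambda>h. (exp (l * h) - 1) / h) \<longlongrightarrow> l) (at_right 0)"
  proof -
    have "((\<lambda>h. exp (l * h)) has_real_derivative l) (at 0)"
      by (auto intro!: derivative_eq_intros)
    then have "((\<lambda>h. (exp (l * h) - 1) / h) \<longlongrightarrow> l) (at 0)"
      by (simp add: DERIV_def)
    then show ?thesis by (rule tendsto_within_subset) simp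
  qed
  moreover have "((\<lambda>h. exp (l * h)) \<longlongrightarrow> exp (l * 0)) (at_right 0)"
    by (intro tendsto_intros)
  ultimately have "((\<lambda>h. ((exp (l * h) - 1) / h) *\<^sub>R laplace l x - exp (l * h) *\<^sub>R ((1 / h) *\<^sub>R partial_laplace l x h))
      \<longlongrightarrow> l *\<^sub>R laplace l x - exp (l * 0) *\<^sub>R x) (at_right 0)"
    by (intro tendsto_diff tendsto_scaleR_lc tendsto_const partial_laplace_average_tendsto)
  then have "((\<lambda>h. ((exp (l * h) - 1) / h) *\<^sub>R laplace l x - exp (l * h) *\<^sub>R ((1 / h) *\<^sub>R partial_laplace l x h))
      \<longlongrightarrow> l *\<^sub>R laplace l x - x) (at_right 0)"
    by simp
  then show ?thesis
  proof (rule Lim_transform_eventually)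
    show "\<forall>\<^sub>F h in at_right 0. ((exp (l * h) - 1) / h) *\<^sub>R laplace l x - exp (l * h) *\<^sub>R ((1 / h) *\<^sub>R partial_laplace l x h)
        = (1 / h) *\<^sub>R (T h (laplace l x) - laplace l x)"
      using eventually_at_right_less[of 0]
    proof eventually_elim
      case (elim h)
      then show ?case
        by (simp add: T_laplace scaleR_diff_right scaleR_diff_left diff_divide_distrib)
    qed
  qed
qed

lemma laplace_in_generator_domain: "laplace l x \<in> generator_domain T"
  and generator_laplace: "generator T (laplace l x) = l *\<^sub>R laplace l x - x"
  using generatorI[of T "laplace l x"] laplace_difference_quotient_tendsto by blast+

text \<open>The transform commutes with difference quotients, hence with the generator on its domain; then
  \<open>generator_laplace\<close> applies.\<close>

lemma laplace_generator:
  assumes x: "x \<in> generator_domain T"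
  shows "laplace l (l *\<^sub>R x - generator T x) = x"
proof -
  note at0 = filterlim_inverse_Suc_at_right
  have "(\<lambda>n. laplace l ((1 / (1 / real (Suc n))) *\<^sub>R (T (1 / real (Suc n)) x - x))) \<longlonglongrightarrow> laplace l (generator T x)"
    by (intro laplace_tendsto filterlim_compose[OF generatorD[OF x] at0])
  moreover have "laplace l ((1 / h) *\<^sub>R (T h x - x)) = (1 / h) *\<^sub>R (T h (laplace l x) - laplace l x)"
    if "h \<ge> 0" for h
    using that by (simp add: linear_scale[OF linear_laplace] linear_diff[OF linear_laplace] laplace_T)
  then have "(\<lambda>n. laplace l ((1 / (1 / real (Suc n))) *\<^sub>R (T (1 / real (Suc n)) x - x)))
      = (\<lambda>n. (1 / (1 / real (Suc n))) *\<^sub>R (T (1 / real (Suc n)) (laplace l x) - laplace l x))"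
    by (intro ext) (simp only: of_nat_0_le_iff zero_le_divide_1_iff)
  then have "(\<lambda>n. laplace l ((1 / (1 / real (Suc n))) *\<^sub>R (T (1 / real (Suc n)) x - x))) \<longlonglongrightarrow> l *\<^sub>R laplace l x - x"
    using filterlim_compose[OF laplace_difference_quotient_tendsto at0] by (simp only:)
  ultimately have "laplace l (generator T x) = l *\<^sub>R laplace l x - x"
    by (rule LIMSEQ_unique)
  then show ?thesis
    by (simp add: linear_scale[OF linear_laplace] linear_diff[OF linear_laplace])
qed

lemma bij_betw_generator: "bij_betw (\<lambda>x. l *\<^sub>R x - generator T x) (generator_domain T) UNIV"
  by (rule bij_betw_byWitness[where f' = "laplace l"])
     (auto simp: laplace_generator generator_laplace laplace_in_generator_domain)

text \<open>By \<open>T_laplace\<close> the averages of \<open>partial_laplace_average_tendsto\<close> are values of \<open>laplace l\<close>.\<close>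

lemma seq_dense_generator_domain: "seq_dense (generator_domain T)"
  unfolding seq_dense_def
proof
  fix x
  define v where "v h = (1 / h) *\<^sub>R partial_laplace l x h" for h
  have "v h \<in> generator_domain T" if "h > 0" for h
  proof -
    have "partial_laplace l x h = laplace l x - exp (- (l * h)) *\<^sub>R T h (laplace l x)"
      using that by (simp add: T_laplace exp_minus)
    then have "v h = laplace l ((1 / h) *\<^sub>R (x - exp (- (l * h)) *\<^sub>R T h x))"
      using that by (simp add: v_def linear_scale[OF linear_laplace] linear_diff[OF linear_laplace] laplace_T)
    then show ?thesis by (simp add: laplace_in_generator_domain)
  qed
  moreover have "(\<lambda>n. v (1 / real (Suc n))) \<longlonglongrightarrow> x"
    unfolding v_def by (rule filterlim_compose[OF partial_laplace_average_tendsto filterlim_inverse_Suc_at_right])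
  ultimately show "\<exists>xs. (\<forall>n. xs n \<in> generator_domain T) \<and> xs \<longlonglongrightarrow> x"
    by (intro exI[of _ "\<lambda>n. v (1 / real (Suc n))"]) simp
qed

text \<open>The graph is the preimage of the diagonal under the sequentially continuous map sending \<open>(x, y)\<close>
  to the pair of \<open>x\<close> and \<open>laplace l (l * x - y)\<close>.\<close>

lemma seq_closed_generator: "seq_closed {(x, generator T x) | x. x \<in> generator_domain T}"
  unfolding seq_closed_def
proof (intro allI impI, elim conjE)
  fix zs :: "nat \<Rightarrow> 'a \<times> 'a" and z
  assume graph: "\<forall>n. zs n \<in> {(x, generator T x) | x. x \<in> generator_domain T}" and lim: "zs \<longlonglongrightarrow> z"
  have zs: "fst (zs n) \<in> generator_domain T" "snd (zs n) = generator T (fst (zs n))" for n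
    using graph by (auto dest: spec[of _ n])
  have fst: "(\<lambda>n. fst (zs n)) \<longlonglongrightarrow> fst z" and snd: "(\<lambda>n. snd (zs n)) \<longlonglongrightarrow> snd z"
    using lim by (auto intro: tendsto_fst tendsto_snd)
  have "(\<lambda>n. laplace l (l *\<^sub>R fst (zs n) - snd (zs n))) \<longlonglongrightarrow> laplace l (l *\<^sub>R fst z - snd z)"
    by (intro laplace_tendsto tendsto_diff tendsto_scaleR_lc tendsto_const fst snd)
  moreover have "laplace l (l *\<^sub>R fst (zs n) - snd (zs n)) = fst (zs n)" for n
    by (simp add: zs laplace_generator)
  ultimately have "fst z = laplace l (l *\<^sub>R fst z - snd z)"
    using fst LIMSEQ_unique by auto
  then have "fst z \<in> generator_domain T" "generator T (fst z) = snd z"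
    using laplace_in_generator_domain generator_laplace[of "l *\<^sub>R fst z - snd z"] by (metis, simp)
  then show "z \<in> {(x, generator T x) | x. x \<in> generator_domain T}"
    by (cases z) auto
qed

end

lemma equicontinuous_laplace_powers:
  assumes "\<And>n :: nat. L n > 0"
  shows "seq_equicontinuous UNIV (\<lambda>(n, m). (\<lambda>x. L n *\<^sub>R laplace (L n) x) ^^ m)"
proof (rule seq_equicontinuousI, goal_cases)
  case (1 i)
  have "linear (\<lambda>x. L n *\<^sub>R laplace (L n) x)" for n
    by (intro linear_compose_scale_right linear_laplace assms)
  then show ?case by (simp add: case_prod_beta linear_funpow)
next
  case (2 p)
  then show ?case
    using order_trans[OF le_orbit_sup[of p 0] orbit_sup_laplace_power[OF assms, of p]]
      seq_seminorm_orbit_sup[OF 2]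
    by (intro exI[of _ "orbit_sup p"]) (auto simp: T_0)
qed

end

section \<open>Comparison of powers of two resolvents\<close>

lemma convex_combination_sqrt_le:
  fixes u v \<alpha> :: real
  assumes "0 \<le> u" "0 \<le> v" "0 \<le> \<alpha>" "\<alpha> \<le> 1"
  shows "\<alpha> * sqrt u + (1 - \<alpha>) * sqrt v \<le> sqrt (\<alpha> * u + (1 - \<alpha>) * v)"
proof (rule real_le_rsqrt)
  have "\<alpha> * u + (1 - \<alpha>) * v - (\<alpha> * sqrt u + (1 - \<alpha>) * sqrt v)\<^sup>2
      = \<alpha> * (sqrt u)\<^sup>2 + (1 - \<alpha>) * (sqrt v)\<^sup>2 - (\<alpha> * sqrt u + (1 - \<alpha>) * sqrt v)\<^sup>2"
    using assms by simp
  also have "\<dots> = \<alpha> * (1 - \<alpha>) * (sqrt u - sqrt v)\<^sup>2"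
    by (simp add: power2_eq_square algebra_simps)
  finally have "\<alpha> * u + (1 - \<alpha>) * v - (\<alpha> * sqrt u + (1 - \<alpha>) * sqrt v)\<^sup>2
      = \<alpha> * (1 - \<alpha>) * (sqrt u - sqrt v)\<^sup>2" .
  moreover have "0 \<le> \<alpha> * (1 - \<alpha>) * (sqrt u - sqrt v)\<^sup>2"
    using assms by simp
  ultimately show "(\<alpha> * sqrt u + (1 - \<alpha>) * sqrt v)\<^sup>2 \<le> \<alpha> * u + (1 - \<alpha>) * v"
    by linarith
qed

lemma nonexpansive_power_minus_id:
  fixes K :: "'a::real_vector \<Rightarrow> 'a"
  assumes q: "seminorm q" and K: "linear K" "\<And>y. q (K y) \<le> q y"
  shows "q ((K ^^ k) x - x) \<le> real k * q (K x - x)"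
proof (induction k)
  case (Suc k)
  have "q ((K ^^ Suc k) x - x) \<le> q (K ((K ^^ k) x) - K x) + q (K x - x)"
    using seminorm_triangle[OF q] by simp
  also have "K ((K ^^ k) x) - K x = K ((K ^^ k) x - x)"
    by (simp add: linear_diff[OF K(1)])
  also have "q \<dots> \<le> q ((K ^^ k) x - x)"
    by (rule K(2))
  finally show ?case
    using Suc by (simp add: algebra_simps)
qed (simp add: seminorm_0[OF q])

text \<open>Here \<open>J\<close> and \<open>K\<close> play the role of Euler steps of lengths \<open>\<sigma> \<le> \<tau>\<close>. Iterating the resolvent identity
  formally writes \<open>K\<^sup>k x\<close> as the mean of \<open>J\<^sup>S x\<close>, where \<open>S\<close> is the number of trials up to the \<open>k\<close>-th
  success, with success probability \<open>\<sigma> / \<tau>\<close>; this suggests a bound in terms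
  of the root mean square deviation of \<open>S * \<sigma>\<close> from \<open>l * \<sigma>\<close>. The induction on \<open>l\<close> replaces the probabilistic argument: one application of
  the identity leads from \<open>(k, Suc l)\<close> to \<open>(k - 1, l)\<close> with weight \<open>\<sigma> / \<tau>\<close> and to \<open>(k, l)\<close> with the
  remaining weight, and by concavity of the square root the claim reduces to an inequality between
  quadratic polynomials.\<close>

lemma crandall_liggett_estimate:
  fixes J K :: "'a::real_vector \<Rightarrow> 'a" and \<tau> \<sigma> :: real
  assumes q: "seminorm q"
    and J: "linear J" "\<And>y. q (J y) \<le> q y" and K: "linear K" "\<And>y. q (K y) \<le> q y"
    and step: "0 < \<sigma>" "\<sigma> \<le> \<tau>"
    and resolvent_identity: "\<And>y. K y = J ((\<sigma> / \<tau>) *\<^sub>R y + (1 - \<sigma> / \<tau>) *\<^sub>R K y)"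
    and Jx: "q (J x - x) \<le> \<sigma> * c" and Kx: "q (K x - x) \<le> \<tau> * c"
  shows "q ((K ^^ k) x - (J ^^ l) x) \<le> c * sqrt ((real k * \<tau> - real l * \<sigma>)\<^sup>2 + real l * \<tau> * \<sigma>)"
proof -
  have "0 \<le> \<sigma> * c" using Jx seminorm_nonneg[OF q] by (rule order_trans[rotated])
  then have c: "0 \<le> c" using step by (simp add: zero_le_mult_iff)
  show ?thesis
  proof (induction l arbitrary: k)
    case 0
    have "q ((K ^^ k) x - x) \<le> real k * q (K x - x)"
      by (rule nonexpansive_power_minus_id[OF q K])
    also have "\<dots> \<le> real k * (\<tau> * c)"
      by (intro mult_left_mono Kx) simp
    finally have "q ((K ^^ k) x - x) \<le> real k * (\<tau> * c)" .
    then show ?case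
      using step by (simp add: real_sqrt_mult abs_mult mult.commute mult.left_commute)
  next
    case (Suc l)
    show ?case
    proof (cases k)
      case 0
      have "q ((J ^^ Suc l) x - x) \<le> real (Suc l) * q (J x - x)"
        by (rule nonexpansive_power_minus_id[OF q J])
      also have "\<dots> \<le> real (Suc l) * (\<sigma> * c)"
        by (intro mult_left_mono Jx) simp
      also have "\<dots> = c * sqrt ((real (Suc l) * \<sigma>)\<^sup>2)"
        using step by simp
      also have "\<dots> \<le> c * sqrt ((real k * \<tau> - real (Suc l) * \<sigma>)\<^sup>2 + real (Suc l) * \<tau> * \<sigma>)"
        using step c 0 by (intro mult_left_mono real_sqrt_le_mono) simp_all
      finally show ?thesis
        using seminorm_diff_commute[OF q, of "(K ^^ k) x"] 0 by simp
    next
      case k: (Suc k')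
      define \<alpha> where "\<alpha> = \<sigma> / \<tau>"
      have \<alpha>: "0 \<le> \<alpha>" "\<alpha> \<le> 1" "\<alpha> * \<tau> = \<sigma>" using step by (auto simp: \<alpha>_def)
      define u where "u = (real k' * \<tau> - real l * \<sigma>)\<^sup>2 + real l * \<tau> * \<sigma>"
      define v where "v = (real k * \<tau> - real l * \<sigma>)\<^sup>2 + real l * \<tau> * \<sigma>"
      have uv: "0 \<le> u" "0 \<le> v" using step by (auto simp: u_def v_def)
      have "(K ^^ k) x - (J ^^ Suc l) x
          = J (\<alpha> *\<^sub>R (K ^^ k') x + (1 - \<alpha>) *\<^sub>R (K ^^ k) x) - J ((J ^^ l) x)"
        using resolvent_identity[of "(K ^^ k') x"] by (simp add: k \<alpha>_def)
      also have "\<dots> = J (\<alpha> *\<^sub>R ((K ^^ k') x - (J ^^ l) x) + (1 - \<alpha>) *\<^sub>R ((K ^^ k) x - (J ^^ l) x))"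
        by (simp add: linear_diff[OF J(1), symmetric] algebra_simps)
      also have "q \<dots> \<le> q (\<alpha> *\<^sub>R ((K ^^ k') x - (J ^^ l) x) + (1 - \<alpha>) *\<^sub>R ((K ^^ k) x - (J ^^ l) x))"
        by (rule J(2))
      also have "\<dots> \<le> \<alpha> * q ((K ^^ k') x - (J ^^ l) x) + (1 - \<alpha>) * q ((K ^^ k) x - (J ^^ l) x)"
        using \<alpha> by (intro order_trans[OF seminorm_add[OF q]]) (simp add: seminorm_scaleR[OF q])
      also have "\<dots> \<le> \<alpha> * (c * sqrt u) + (1 - \<alpha>) * (c * sqrt v)"
        unfolding u_def v_def using \<alpha> by (intro add_mono mult_left_mono Suc.IH) auto
      also have "\<dots> = c * (\<alpha> * sqrt u + (1 - \<alpha>) * sqrt v)"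
        by (simp add: algebra_simps)
      also have "\<dots> \<le> c * sqrt (\<alpha> * u + (1 - \<alpha>) * v)"
        by (intro mult_left_mono convex_combination_sqrt_le uv \<alpha> c)
      also have "\<dots> \<le> c * sqrt ((real k * \<tau> - real (Suc l) * \<sigma>)\<^sup>2 + real (Suc l) * \<tau> * \<sigma>)"
      proof (intro mult_left_mono real_sqrt_le_mono c)
        define d where "d = real k * \<tau> - real (Suc l) * \<sigma>"
        have u: "u = (d + \<sigma> - \<tau>)\<^sup>2 + real l * \<tau> * \<sigma>" and v: "v = (d + \<sigma>)\<^sup>2 + real l * \<tau> * \<sigma>"
          by (simp_all add: u_def v_def d_def k algebra_simps)
        have "\<alpha> * u + (1 - \<alpha>) * v = (d + \<sigma>)\<^sup>2 - 2 * (\<alpha> * \<tau>) * (d + \<sigma>) + (\<alpha> * \<tau>) * \<tau> + real l * \<tau> * \<sigma>"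
          unfolding u v by (simp add: power2_eq_square algebra_simps)
        also have "\<dots> = d\<^sup>2 - \<sigma>\<^sup>2 + real (Suc l) * \<tau> * \<sigma>"
          unfolding \<alpha>(3) by (simp add: power2_eq_square algebra_simps)
        finally show "\<alpha> * u + (1 - \<alpha>) * v \<le> (real k * \<tau> - real (Suc l) * \<sigma>)\<^sup>2 + real (Suc l) * \<tau> * \<sigma>"
          by (simp add: d_def)
      qed
      finally show ?thesis .
    qed
  qed
qed

section \<open>The semigroup generated by an operator with equicontinuous resolvent powers\<close>

locale hille_yosida =
  fixes D :: "'a::locally_convex_t2_space set" and A :: "'a \<Rightarrow> 'a" and L :: "nat \<Rightarrow> real"
  assumes complete: "\<forall>xs :: nat \<Rightarrow> 'a. tvs_Cauchy xs \<longrightarrow> convergent xs"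
    and linear_A: "linear_operator D A" and dense: "seq_dense D"
    and L_pos: "\<And>n. L n > 0" and L_at_top: "filterlim L at_top sequentially"
    and bij: "\<And>n. bij_betw (\<lambda>x. L n *\<^sub>R x - A x) D UNIV"
    and equicontinuous:
      "seq_equicontinuous UNIV (\<lambda>(n, m). (\<lambda>x. L n *\<^sub>R resolvent D A (L n) x) ^^ m)"
begin

definition J :: "nat \<Rightarrow> 'a \<Rightarrow> 'a" where
  "J n x = L n *\<^sub>R resolvent D A (L n) x"

lemma D_add: "x \<in> D \<Longrightarrow> y \<in> D \<Longrightarrow> x + y \<in> D"
  and D_scaleR: "x \<in> D \<Longrightarrow> c *\<^sub>R x \<in> D"
  and A_add: "x \<in> D \<Longrightarrow> y \<in> D \<Longrightarrow> A (x + y) = A x + A y"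
  and A_scaleR: "x \<in> D \<Longrightarrow> A (c *\<^sub>R x) = c *\<^sub>R A x"
  using linear_A by (auto simp: linear_operator_def subspace_def)

lemma resolvent_in_D: "resolvent D A (L n) y \<in> D"
  unfolding resolvent_def using bij[of n] by (intro the_inv_into_into) (auto simp: bij_betw_def)

lemma resolvent_right: "L n *\<^sub>R resolvent D A (L n) y - A (resolvent D A (L n) y) = y"
  unfolding resolvent_def using bij[of n] by (intro f_the_inv_into_f) (auto simp: bij_betw_def)

lemma resolvent_eqI: "x \<in> D \<Longrightarrow> L n *\<^sub>R x - A x = y \<Longrightarrow> resolvent D A (L n) y = x"
  unfolding resolvent_def using bij[of n] by (intro the_inv_into_f_eq) (auto simp: bij_betw_def)

lemma linear_resolvent: "linear (resolvent D A (L n))"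
proof (rule linearI)
  fix x y :: 'a and c :: real
  let ?R = "resolvent D A (L n)"
  show "?R (x + y) = ?R x + ?R y"
    using resolvent_right[of n x] resolvent_right[of n y]
    by (intro resolvent_eqI) (simp_all add: D_add resolvent_in_D A_add algebra_simps)
  show "?R (c *\<^sub>R x) = c *\<^sub>R ?R x"
    using arg_cong[OF resolvent_right[of n x], of "\<lambda>y. c *\<^sub>R y"]
    by (intro resolvent_eqI) (simp_all add: D_scaleR resolvent_in_D A_scaleR algebra_simps)
qed

lemma linear_J: "linear (J n)"
  unfolding J_def[abs_def] by (intro linear_compose_scale_right linear_resolvent)

text \<open>This is \<open>J n - 1 = A \<circ> R = R \<circ> A\<close> on the domain, with \<open>R\<close> the resolvent at \<open>L n\<close>.\<close>

lemma J_minus_id: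
  assumes "x \<in> D"
  shows "J n x - x = (1 / L n) *\<^sub>R J n (A x)"
proof -
  have "resolvent D A (L n) (L n *\<^sub>R x - A x) = x" using assms by (intro resolvent_eqI) auto
  then show ?thesis
    using L_pos[of n]
    by (simp add: J_def linear_diff[OF linear_resolvent] linear_scale[OF linear_resolvent] algebra_simps)
qed

lemma J_resolvent_identity: "J n y = J m ((L n / L m) *\<^sub>R y + (1 - L n / L m) *\<^sub>R J n y)"
proof -
  let ?u = "resolvent D A (L n) y"
  have "resolvent D A (L m) (y + (L m - L n) *\<^sub>R ?u) = ?u"
    using resolvent_right[of n y] by (intro resolvent_eqI resolvent_in_D) (simp add: algebra_simps)
  then have "J n y = L n *\<^sub>R resolvent D A (L m) (y + (L m - L n) *\<^sub>R ?u)"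
    by (simp add: J_def)
  also have "\<dots> = L m *\<^sub>R resolvent D A (L m) ((L n / L m) *\<^sub>R (y + (L m - L n) *\<^sub>R ?u))"
    using L_pos[of m] by (simp add: linear_scale[OF linear_resolvent])
  also have "(L n / L m) *\<^sub>R (y + (L m - L n) *\<^sub>R ?u) = (L n / L m) *\<^sub>R y + (1 - L n / L m) *\<^sub>R J n y"
  proof -
    have "(L n / L m) * (L m - L n) = (1 - L n / L m) * L n"
      using L_pos[of m] by (simp add: field_simps)
    then show ?thesis by (simp add: J_def scaleR_add_right)
  qed
  finally show ?thesis unfolding J_def[of m] .
qed

lemma linear_J_power: "linear (J n ^^ k)"
  by (rule linear_funpow[OF linear_J])

lemma equicontinuous_J: "seq_equicontinuous UNIV (\<lambda>(n, m). J n ^^ m)"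
  using equicontinuous by (simp add: J_def[abs_def])

abbreviation power_sup :: "('a \<Rightarrow> real) \<Rightarrow> 'a \<Rightarrow> real" where
  "power_sup p \<equiv> sup_seminorm UNIV (\<lambda>(n, m). J n ^^ m) p"

lemma seq_seminorm_power_sup: "cont_seminorm p \<Longrightarrow> seq_seminorm (power_sup p)"
  by (rule seq_seminorm_sup_seminorm[OF equicontinuous_J]) (auto intro: linear_J_power)

lemma le_power_sup: "cont_seminorm p \<Longrightarrow> p ((J n ^^ k) x) \<le> power_sup p x"
  using sup_seminorm_upper[OF equicontinuous_J, of p "(n, k)" x] linear_J_power by auto

lemma equicontinuous_J_power: "seq_equicontinuous UNIV (\<lambda>k. J n ^^ k)"
  using equicontinuous_reindex[OF equicontinuous_J, of "Pair n" UNIV] by simp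

abbreviation single_power_sup :: "nat \<Rightarrow> ('a \<Rightarrow> real) \<Rightarrow> 'a \<Rightarrow> real" where
  "single_power_sup n p \<equiv> sup_seminorm UNIV (\<lambda>k. J n ^^ k) p"

lemma seminorm_single_power_sup: "cont_seminorm p \<Longrightarrow> seminorm (single_power_sup n p)"
  by (rule seq_seminorm_imp_seminorm, rule seq_seminorm_sup_seminorm[OF equicontinuous_J_power])
     (auto intro: linear_J_power)

lemma le_single_power_sup: "cont_seminorm p \<Longrightarrow> p ((J n ^^ k) x) \<le> single_power_sup n p x"
  by (rule sup_seminorm_upper[OF equicontinuous_J_power]) (auto intro: linear_J_power)

lemma single_power_sup_le: "cont_seminorm p \<Longrightarrow> single_power_sup n p x \<le> power_sup p x"
  unfolding sup_seminorm_def[of _ _ _ x, where f = "\<lambda>k. J n ^^ k"]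
  by (rule cSUP_least) (auto intro: le_power_sup)

lemma single_power_sup_J_same:
  assumes "cont_seminorm p"
  shows "single_power_sup n p (J n x) \<le> single_power_sup n p x"
  unfolding sup_seminorm_def[of _ _ _ "J n x"]
proof (rule cSUP_least)
  fix k
  show "p ((J n ^^ k) (J n x)) \<le> single_power_sup n p x"
    using le_single_power_sup[OF assms, of "Suc k" n x] by (simp add: funpow_swap1)
qed simp

text \<open>By the resolvent identity, \<open>J n y\<close> is \<open>J m\<close> applied to a convex combination of \<open>y\<close> and \<open>J n y\<close>
  itself, where \<open>y\<close> has positive weight. As \<open>J m\<close> is nonexpansive, the seminorm of \<open>J n y\<close> is
  at most a convex combination of those of \<open>y\<close> and \<open>J n y\<close>, hence at most that of \<open>y\<close>.\<close>

lemma single_power_sup_J: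
  assumes p: "cont_seminorm p" and "L n \<le> L m"
  shows "single_power_sup m p (J n y) \<le> single_power_sup m p y"
proof -
  let ?Q = "single_power_sup m p"
  note s = seminorm_single_power_sup[OF p, of m]
  define \<alpha> where "\<alpha> = L n / L m"
  have \<alpha>: "0 < \<alpha>" "\<alpha> \<le> 1" using assms(2) L_pos by (auto simp: \<alpha>_def)
  have "?Q (J n y) \<le> ?Q (\<alpha> *\<^sub>R y + (1 - \<alpha>) *\<^sub>R J n y)"
    using single_power_sup_J_same[OF p, of m "\<alpha> *\<^sub>R y + (1 - \<alpha>) *\<^sub>R J n y"] J_resolvent_identity[of n y m]
    by (simp add: \<alpha>_def)
  also have "\<dots> \<le> \<alpha> * ?Q y + (1 - \<alpha>) * ?Q (J n y)"
    using \<alpha> by (intro order_trans[OF seminorm_add[OF s]]) (simp add: seminorm_scaleR[OF s])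
  finally have "\<alpha> * ?Q (J n y) \<le> \<alpha> * ?Q y" by (simp add: algebra_simps)
  then show ?thesis using \<alpha> by simp
qed

text \<open>The seminorm \<open>single_power_sup m p\<close>, adapted to \<open>m\<close>, makes both \<open>J n\<close> and \<open>J m\<close> nonexpansive. It lies
  between \<open>p\<close> and \<open>power_sup p\<close>, so it disappears from the result.\<close>

lemma J_powers_close:
  assumes p: "cont_seminorm p" and x: "x \<in> D" and "L n \<le> L m"
  shows "p ((J n ^^ k) x - (J m ^^ l) x) \<le>
    power_sup p (A x) * sqrt ((real k / L n - real l / L m)\<^sup>2 + real l / L m * (1 / L n))"
proof -
  let ?Q = "single_power_sup m p"
  note s = seminorm_single_power_sup[OF p, of m]
  have J_x: "?Q (J i x - x) \<le> (1 / L i) * ?Q (A x)" if "L i \<le> L m" for i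
    using single_power_sup_J[OF p that, of "A x"] L_pos[of i]
    by (simp add: J_minus_id[OF x] seminorm_scaleR[OF s] divide_right_mono)
  have "p ((J n ^^ k) x - (J m ^^ l) x) \<le> ?Q ((J n ^^ k) x - (J m ^^ l) x)"
    using le_single_power_sup[OF p, of 0 m] by simp
  also have "\<dots> \<le> ?Q (A x) * sqrt ((real k * (1 / L n) - real l * (1 / L m))\<^sup>2 + real l * (1 / L n) * (1 / L m))"
  proof (rule crandall_liggett_estimate[OF s linear_J single_power_sup_J[OF p order_refl]
        linear_J single_power_sup_J[OF p assms(3)] _ _ _ J_x[OF order_refl] J_x[OF assms(3)]])
    show "J n y = J m ((1 / L m / (1 / L n)) *\<^sub>R y + (1 - 1 / L m / (1 / L n)) *\<^sub>R J n y)" for y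
      using J_resolvent_identity[of n y m] by simp
    show "0 < 1 / L m" "1 / L m \<le> 1 / L n"
      using assms(3) L_pos by (auto intro: frac_le)
  qed
  also have "\<dots> \<le> power_sup p (A x) * sqrt ((real k * (1 / L n) - real l * (1 / L m))\<^sup>2 + real l * (1 / L n) * (1 / L m))"
    using L_pos[of n] L_pos[of m] by (intro mult_right_mono single_power_sup_le p) simp
  finally show ?thesis by (simp add: mult.commute)
qed

lemma J_power_diff:
  assumes "x \<in> D" "l \<le> k"
  shows "(J n ^^ k) x - (J n ^^ l) x = (\<Sum>j=l..<k. (1 / L n) *\<^sub>R (J n ^^ Suc j) (A x))"
  using assms(2)
proof (induction k rule: dec_induct)
  case (step k)
  have "(J n ^^ Suc k) x - (J n ^^ k) x = (J n ^^ k) (J n x - x)"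
    by (simp add: linear_diff[OF linear_J_power] funpow_swap1)
  also have "\<dots> = (1 / L n) *\<^sub>R (J n ^^ Suc k) (A x)"
    by (simp add: J_minus_id[OF assms(1)] linear_scale[OF linear_J_power] funpow_swap1)
  finally show ?case
    using step by (simp add: algebra_simps)
qed simp

lemma J_power_modulus_D:
  assumes p: "cont_seminorm p" and z: "z \<in> D"
  shows "p ((J n ^^ k) z - (J n ^^ l) z) \<le> \<bar>real k / L n - real l / L n\<bar> * power_sup p (A z)"
proof -
  note s = cont_seminorm_imp_seminorm[OF p]
  have le: "p ((J n ^^ k) z - (J n ^^ l) z) \<le> (real k / L n - real l / L n) * power_sup p (A z)"
    if "l \<le> k" for k l
  proof -
    have "p ((J n ^^ k) z - (J n ^^ l) z) \<le> (\<Sum>j=l..<k. p ((1 / L n) *\<^sub>R (J n ^^ Suc j) (A z)))"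
      unfolding J_power_diff[OF z that] by (rule seminorm_sum[OF s])
    also have "\<dots> \<le> (\<Sum>j=l..<k. (1 / L n) * power_sup p (A z))"
    proof (rule sum_mono)
      fix j
      have "p ((1 / L n) *\<^sub>R (J n ^^ Suc j) (A z)) = (1 / L n) * p ((J n ^^ Suc j) (A z))"
        using L_pos[of n] by (simp add: seminorm_scaleR[OF s] del: funpow.simps)
      also have "\<dots> \<le> (1 / L n) * power_sup p (A z)"
        using L_pos[of n] by (intro mult_left_mono le_power_sup p) simp
      finally show "p ((1 / L n) *\<^sub>R (J n ^^ Suc j) (A z)) \<le> (1 / L n) * power_sup p (A z)" .
    qed
    also have "\<dots> = (real k / L n - real l / L n) * power_sup p (A z)"
      using that by (simp add: of_nat_diff diff_divide_distrib algebra_simps)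
    finally show ?thesis .
  qed
  have mono: "real l / L n \<le> real k / L n" if "l \<le> k" for k l
    using that L_pos[of n] by (simp add: divide_right_mono)
  show ?thesis
  proof (cases "l \<le> k")
    case True
    then show ?thesis using le[OF True] mono[OF True] by simp
  next
    case False
    then show ?thesis
      using le[of k l] mono[of k l] seminorm_diff_commute[OF s, of "(J n ^^ k) z"] by simp
  qed
qed

text \<open>Approximating \<open>x\<close> by \<open>z\<close> in the domain makes the first summand small uniformly in \<open>n\<close>, \<open>k\<close> and
  \<open>l\<close>; the second one is a Lipschitz estimate in the time \<open>k / L n\<close>.\<close>

lemma J_power_modulus:
  assumes p: "cont_seminorm p" and z: "z \<in> D"
  shows "p ((J n ^^ k) x - (J n ^^ l) x) \<le>
    2 * power_sup p (x - z) + \<bar>real k / L n - real l / L n\<bar> * power_sup p (A z)"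
proof -
  note s = cont_seminorm_imp_seminorm[OF p]
  let ?u = "(J n ^^ k) (x - z)" and ?v = "(J n ^^ l) (x - z)" and ?w = "(J n ^^ k) z - (J n ^^ l) z"
  have "(J n ^^ k) x - (J n ^^ l) x = ?u - ?v + ?w"
    by (simp add: linear_diff[OF linear_J_power])
  then have "p ((J n ^^ k) x - (J n ^^ l) x) \<le> (p ?u + p ?v) + p ?w"
    using seminorm_add[OF s, of "?u - ?v" ?w] seminorm_diff[OF s, of ?u ?v] by simp
  then show ?thesis
    using le_power_sup[OF p, of k n "x - z"] le_power_sup[OF p, of l n "x - z"]
      J_power_modulus_D[OF p z, of k n l] by linarith
qed

lemma approximate_from_D:
  assumes "seq_seminorm q" "e > 0"
  shows "\<exists>z\<in>D. q (x - z) < e"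
proof -
  obtain zs where zs: "\<And>n. zs n \<in> D" "zs \<longlonglongrightarrow> x"
    using dense unfolding seq_dense_def by blast
  have "eventually (\<lambda>n. q (zs n - x) < e) sequentially"
    using order_tendstoD(2)[OF tendsto_seq_seminorm[OF assms(1) zs(2)] assms(2)] .
  then obtain n where "q (zs n - x) < e" by (auto simp: eventually_sequentially)
  then show ?thesis
    using zs(1) seminorm_diff_commute[OF seq_seminorm_imp_seminorm[OF assms(1)], of x] by metis
qed

definition steps :: "nat \<Rightarrow> real \<Rightarrow> nat" where
  "steps n t = nat \<lfloor>L n * t\<rfloor>"

lemma inverse_L_tendsto: "(\<lambda>n. 1 / L n) \<longlonglongrightarrow> 0"
  using tendsto_inverse_0_at_top[OF L_at_top] by (simp add: inverse_eq_divide)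

lemma steps_bounds:
  assumes "t \<ge> 0"
  shows "t - 1 / L n \<le> real (steps n t) / L n" "real (steps n t) / L n \<le> t"
proof -
  have "0 \<le> L n * t" using assms L_pos[of n] by simp
  then have "real (steps n t) = of_int \<lfloor>L n * t\<rfloor>" by (simp add: steps_def)
  then have "L n * t - 1 \<le> real (steps n t)" "real (steps n t) \<le> L n * t" by linarith+
  then show "t - 1 / L n \<le> real (steps n t) / L n" "real (steps n t) / L n \<le> t"
        using divide_right_mono[of "L n * t - 1" "real (steps n t)" "L n"]
      divide_right_mono[of "real (steps n t)" "L n * t" "L n"] L_pos[of n]
    by (simp_all add: diff_divide_distrib)
qed

lemma steps_tendsto:
  assumes "t \<ge> 0"
  shows "(\<lambda>n. real (steps n t) / L n) \<longlonglongrightarrow> t"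
proof (rule tendsto_sandwich[OF _ _ _ tendsto_const])
  show "(\<lambda>n. t - 1 / L n) \<longlonglongrightarrow> t"
    using tendsto_diff[OF tendsto_const inverse_L_tendsto, of t] by simp
qed (use steps_bounds[OF assms] in auto)

text \<open>The bound is symmetric in \<open>n\<close> and \<open>m\<close>, unlike that of \<open>J_powers_close\<close>, and tends to \<open>0\<close> as both
  grow.\<close>

lemma J_steps_close:
  assumes p: "cont_seminorm p" and x: "x \<in> D" and t: "t \<ge> 0"
  shows "p ((J n ^^ steps n t) x - (J m ^^ steps m t) x) \<le>
    power_sup p (A x) * sqrt ((1 / L n + 1 / L m)\<^sup>2 + t * (1 / L n + 1 / L m))"
proof -
  note s = cont_seminorm_imp_seminorm[OF p]
  have pos: "0 < 1 / L i" for i using L_pos[of i] by simp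
  have le: "p ((J n ^^ steps n t) x - (J m ^^ steps m t) x) \<le>
      power_sup p (A x) * sqrt ((1 / L n + 1 / L m)\<^sup>2 + t * (1 / L n + 1 / L m))"
    if "L n \<le> L m" for n m
  proof -
    have "\<bar>real (steps n t) / L n - real (steps m t) / L m\<bar> \<le> \<bar>1 / L n + 1 / L m\<bar>"
      using steps_bounds[OF t, of n] steps_bounds[OF t, of m] pos[of n] pos[of m] by linarith
    then have "(real (steps n t) / L n - real (steps m t) / L m)\<^sup>2 \<le> (1 / L n + 1 / L m)\<^sup>2"
      by (rule abs_le_square_iff[THEN iffD1])
    moreover have "real (steps m t) / L m * (1 / L n) \<le> t * (1 / L n + 1 / L m)"
      using steps_bounds[OF t, of m] pos[of n] pos[of m] t by (intro mult_mono) auto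
    ultimately have "sqrt ((real (steps n t) / L n - real (steps m t) / L m)\<^sup>2 + real (steps m t) / L m * (1 / L n))
        \<le> sqrt ((1 / L n + 1 / L m)\<^sup>2 + t * (1 / L n + 1 / L m))"
      by (intro real_sqrt_le_mono add_mono)
    then show ?thesis
      using J_powers_close[OF p x that, of "steps n t" "steps m t"]
        seminorm_nonneg[OF seq_seminorm_imp_seminorm[OF seq_seminorm_power_sup[OF p]], of "A x"]
      by (meson mult_left_mono order_trans)
  qed
  show ?thesis
  proof (cases "L n \<le> L m")
    case False
    then show ?thesis
      using le[of m n] seminorm_diff_commute[OF s, of "(J n ^^ steps n t) x"] by (simp add: add.commute)
  qed (rule le)
qed

definition limit_semigroup :: "real \<Rightarrow> 'a \<Rightarrow> 'a" where
  "limit_semigroup t x = lim (\<lambda>n. (J n ^^ steps n t) x)"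

lemma J_steps_tendsto:
  assumes t: "t \<ge> 0"
  shows "(\<lambda>n. (J n ^^ steps n t) x) \<longlonglongrightarrow> limit_semigroup t x"
proof -
  have "tvs_Cauchy (\<lambda>n. (J n ^^ steps n t) x)"
  proof (rule tvs_CauchyI)
    fix p :: "'a \<Rightarrow> real" and e :: real assume p: "cont_seminorm p" and e: "e > 0"
    note s = cont_seminorm_imp_seminorm[OF p]
    obtain z where z: "z \<in> D" "power_sup p (x - z) < e / 4"
      using approximate_from_D[OF seq_seminorm_power_sup[OF p], of "e / 4" x] e by auto
    define g where "g r = power_sup p (A z) * sqrt (r\<^sup>2 + t * r)" for r
    have "(g \<longlongrightarrow> power_sup p (A z) * sqrt (0\<^sup>2 + t * 0)) (nhds 0)"
      unfolding g_def by (intro tendsto_intros filterlim_ident)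
    then have "eventually (\<lambda>r. g r < e / 2) (nhds 0)"
      using e by (intro order_tendstoD) auto
    then obtain d where d: "d > 0" "\<And>r. \<bar>r\<bar> < d \<Longrightarrow> g r < e / 2"
      by (auto simp: eventually_nhds_metric)
    have "eventually (\<lambda>n. 1 / L n < d / 2) sequentially"
      using order_tendstoD(2)[OF inverse_L_tendsto, of "d / 2"] d(1) by simp
    then obtain N where N: "\<And>n. n \<ge> N \<Longrightarrow> 1 / L n < d / 2"
      by (auto simp: eventually_sequentially)
    have "p ((J n ^^ steps n t) x - (J m ^^ steps m t) x) < e" if "n \<ge> N" "m \<ge> N" for n m
    proof -
      have "\<bar>1 / L n + 1 / L m\<bar> < d"
        using N[OF that(1)] N[OF that(2)] L_pos[of n] L_pos[of m] by simp
      then have "p ((J n ^^ steps n t) z - (J m ^^ steps m t) z) < e / 2"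
        using J_steps_close[OF p z(1) t, of n m] d(2) by (fastforce simp: g_def)
      moreover have "(J n ^^ steps n t) x - (J m ^^ steps m t) x
          = (J n ^^ steps n t) (x - z) - (J m ^^ steps m t) (x - z)
            + ((J n ^^ steps n t) z - (J m ^^ steps m t) z)"
        by (simp add: linear_diff[OF linear_J_power])
      then have "p ((J n ^^ steps n t) x - (J m ^^ steps m t) x) \<le>
          (p ((J n ^^ steps n t) (x - z)) + p ((J m ^^ steps m t) (x - z)))
            + p ((J n ^^ steps n t) z - (J m ^^ steps m t) z)"
        using seminorm_diff[OF s, of "(J n ^^ steps n t) (x - z)" "(J m ^^ steps m t) (x - z)"]
          seminorm_add[OF s, of "(J n ^^ steps n t) (x - z) - (J m ^^ steps m t) (x - z)"
            "(J n ^^ steps n t) z - (J m ^^ steps m t) z"] by simp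
      ultimately show ?thesis
        using z(2) le_power_sup[OF p, of "steps n t" n "x - z"] le_power_sup[OF p, of "steps m t" m "x - z"]
        by linarith
    qed
    then show "\<exists>N. \<forall>n\<ge>N. \<forall>m\<ge>N. p ((J n ^^ steps n t) x - (J m ^^ steps m t) x) < e" by blast
  qed
  then show ?thesis
    using complete convergent_LIMSEQ_iff unfolding limit_semigroup_def by blast
qed

text \<open>The exponents need not be exactly \<open>steps n t\<close>. This flexibility is what the semigroup law requires:
  \<open>steps n t + steps n s\<close> may differ from \<open>steps n (t + s)\<close>.\<close>

lemma J_power_tendsto:
  assumes t: "t \<ge> 0" and k: "(\<lambda>n. real (k n) / L n) \<longlonglongrightarrow> t"
  shows "(\<lambda>n. (J n ^^ k n) x) \<longlonglongrightarrow> limit_semigroup t x"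
proof -
  have "(\<lambda>n. (J n ^^ k n) x - (J n ^^ steps n t) x) \<longlonglongrightarrow> 0"
  proof (rule tendsto_seminormI)
    fix p :: "'a \<Rightarrow> real" assume p: "cont_seminorm p"
    show "(\<lambda>n. p ((J n ^^ k n) x - (J n ^^ steps n t) x - 0)) \<longlonglongrightarrow> 0"
    proof (rule tendstoI)
      fix e :: real assume e: "e > 0"
      obtain z where z: "z \<in> D" "power_sup p (x - z) < e / 4"
        using approximate_from_D[OF seq_seminorm_power_sup[OF p], of "e / 4" x] e by auto
      have "(\<lambda>n. \<bar>real (k n) / L n - real (steps n t) / L n\<bar> * power_sup p (A z)) \<longlonglongrightarrow> \<bar>t - t\<bar> * power_sup p (A z)"
        by (intro tendsto_intros k steps_tendsto t)
      then have "eventually (\<lambda>n. \<bar>real (k n) / L n - real (steps n t) / L n\<bar> * power_sup p (A z) < e / 2) sequentially"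
        using e by (intro order_tendstoD) auto
      then show "\<forall>\<^sub>F n in sequentially. dist (p ((J n ^^ k n) x - (J n ^^ steps n t) x - 0)) 0 < e"
      proof eventually_elim
        case (elim n)
        then show ?case
          using z(2) J_power_modulus[OF p z(1), of "k n" n x "steps n t"]
            seminorm_nonneg[OF cont_seminorm_imp_seminorm[OF p]] by (simp add: abs_of_nonneg)
      qed
    qed
  qed
  then show ?thesis
    using tendsto_add[OF _ J_steps_tendsto[OF t, of x]] by fastforce
qed

lemma limit_semigroup_modulus:
  assumes p: "cont_seminorm p" and z: "z \<in> D" and "t \<ge> 0" "s \<ge> 0"
  shows "p (limit_semigroup t x - limit_semigroup s x) \<le>
    2 * power_sup p (x - z) + \<bar>t - s\<bar> * power_sup p (A z)"
proof (rule seq_seminorm_le_limit[OF cont_seminorm_imp_seq_seminorm[OF p]])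
  show "(\<lambda>n. (J n ^^ steps n t) x - (J n ^^ steps n s) x) \<longlonglongrightarrow> limit_semigroup t x - limit_semigroup s x"
    by (intro tendsto_diff J_steps_tendsto assms)
  show "(\<lambda>n. 2 * power_sup p (x - z) + \<bar>real (steps n t) / L n - real (steps n s) / L n\<bar> * power_sup p (A z))
      \<longlonglongrightarrow> 2 * power_sup p (x - z) + \<bar>t - s\<bar> * power_sup p (A z)"
    by (intro tendsto_intros steps_tendsto assms)
qed (simp add: J_power_modulus[OF p z])

lemma limit_semigroup_bound:
  assumes p: "cont_seminorm p" and "t \<ge> 0"
  shows "p (limit_semigroup t x) \<le> power_sup p x"
  by (rule seq_seminorm_le_limit[OF cont_seminorm_imp_seq_seminorm[OF p] J_steps_tendsto[OF assms(2)] _ tendsto_const])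
     (simp add: le_power_sup[OF p])

lemma limit_semigroup_0: "limit_semigroup 0 x = x"
proof -
  have "(\<lambda>n. (J n ^^ steps n 0) x) = (\<lambda>n. x)" by (simp add: steps_def)
  then show ?thesis using J_steps_tendsto[of 0 x] LIMSEQ_unique[OF tendsto_const] by fastforce
qed

lemma linear_limit_semigroup:
  assumes t: "t \<ge> 0"
  shows "linear (limit_semigroup t)"
proof (rule linearI)
  note lim = J_steps_tendsto[OF t]
  fix x y :: 'a and c :: real
  have "(\<lambda>n. (J n ^^ steps n t) (x + y)) \<longlonglongrightarrow> limit_semigroup t x + limit_semigroup t y"
    using tendsto_add[OF lim[of x] lim[of y]] by (simp add: linear_add[OF linear_J_power])
  then show "limit_semigroup t (x + y) = limit_semigroup t x + limit_semigroup t y"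
    by (rule LIMSEQ_unique[OF lim])
  have "(\<lambda>n. (J n ^^ steps n t) (c *\<^sub>R x)) \<longlonglongrightarrow> c *\<^sub>R limit_semigroup t x"
    using tendsto_scaleR_lc[OF tendsto_const lim[of x], of c] by (simp add: linear_scale[OF linear_J_power])
  then show "limit_semigroup t (c *\<^sub>R x) = c *\<^sub>R limit_semigroup t x"
    by (rule LIMSEQ_unique[OF lim])
qed

text \<open>Both sides are limits of \<open>J n ^^ (steps n t + steps n s)\<close> at \<open>x\<close>; for the right-hand side the error of
  the inner limit passes through the equicontinuous outer powers.\<close>

lemma limit_semigroup_add:
  assumes t: "t \<ge> 0" and s: "s \<ge> 0"
  shows "limit_semigroup (t + s) x = limit_semigroup t (limit_semigroup s x)"
proof (rule LIMSEQ_unique)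
  show "(\<lambda>n. (J n ^^ (steps n t + steps n s)) x) \<longlonglongrightarrow> limit_semigroup (t + s) x"
  proof (rule J_power_tendsto)
    show "(\<lambda>n. real (steps n t + steps n s) / L n) \<longlonglongrightarrow> t + s"
      using tendsto_add[OF steps_tendsto[OF t] steps_tendsto[OF s]] by (simp add: add_divide_distrib)
  qed (use assms in simp)
  have "(\<lambda>n. (J n ^^ steps n t) ((J n ^^ steps n s) x - limit_semigroup s x)) \<longlonglongrightarrow> 0"
  proof (rule tendsto_seminorm_leI)
    fix p :: "'a \<Rightarrow> real" assume p: "cont_seminorm p"
    show "\<exists>g. (\<forall>\<^sub>F n in sequentially. p ((J n ^^ steps n t) ((J n ^^ steps n s) x - limit_semigroup s x) - 0) \<le> g n)
        \<and> g \<longlonglongrightarrow> 0"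
      using tendsto_seq_seminorm[OF seq_seminorm_power_sup[OF p] J_steps_tendsto[OF s, of x]] le_power_sup[OF p]
      by (intro exI[of _ "\<lambda>n. power_sup p ((J n ^^ steps n s) x - limit_semigroup s x)"]) simp
  qed
  from tendsto_add[OF this J_steps_tendsto[OF t, of "limit_semigroup s x"]]
  show "(\<lambda>n. (J n ^^ (steps n t + steps n s)) x) \<longlonglongrightarrow> limit_semigroup t (limit_semigroup s x)"
    by (simp add: linear_diff[OF linear_J_power] funpow_add)
qed

lemma limit_semigroup_at_right_0: "((\<lambda>t. limit_semigroup t x) \<longlongrightarrow> x) (at_right 0)"
proof (rule tendsto_seminormI)
  fix p :: "'a \<Rightarrow> real" assume p: "cont_seminorm p"
  note s = cont_seminorm_imp_seminorm[OF p]
  show "((\<lambda>t. p (limit_semigroup t x - x)) \<longlongrightarrow> 0) (at_right 0)"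
  proof (rule tendstoI)
    fix e :: real assume e: "e > 0"
    obtain z where z: "z \<in> D" "power_sup p (x - z) < e / 4"
      using approximate_from_D[OF seq_seminorm_power_sup[OF p], of "e / 4" x] e by auto
    have "((\<lambda>t. \<bar>t - 0\<bar> * power_sup p (A z)) \<longlongrightarrow> \<bar>0 - 0\<bar> * power_sup p (A z)) (at_right 0)"
      by (intro tendsto_intros)
    then have "eventually (\<lambda>t. \<bar>t - 0\<bar> * power_sup p (A z) < e / 2) (at_right 0)"
      using e by (intro order_tendstoD) auto
    then show "\<forall>\<^sub>F t in at_right 0. dist (p (limit_semigroup t x - x)) 0 < e"
      using eventually_at_right_less[of 0]
    proof eventually_elim
      case (elim t)
      then show ?case
        using z(2) limit_semigroup_modulus[OF p z(1), of t 0 x] seminorm_nonneg[OF s]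
        by (simp add: limit_semigroup_0 abs_of_nonneg)
    qed
  qed
qed

lemma limit_semigroup_C0: "C0_seq_equicontinuous_semigroup limit_semigroup"
  unfolding C0_seq_equicontinuous_semigroup_def
proof (intro conjI allI impI)
  show "seq_equicontinuous {0..} limit_semigroup"
  proof (rule seq_equicontinuousI)
    show "\<exists>q. seq_seminorm q \<and> (\<forall>t\<in>{0..}. \<forall>x. p (limit_semigroup t x) \<le> q x)"
      if p: "cont_seminorm p" for p
      using seq_seminorm_power_sup[OF p] limit_semigroup_bound[OF p]
      by (intro exI[of _ "power_sup p"]) simp
  qed (simp add: linear_limit_semigroup)
qed (auto simp: linear_limit_semigroup limit_semigroup_0 limit_semigroup_add limit_semigroup_at_right_0 fun_eq_iff)

text \<open>Orbits are bounded and uniformly continuous for every continuous seminorm, which gives the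
  integrals over \<open>[0, a]\<close> and their convergence.\<close>

lemma improper_riemann_integral_limit_semigroup:
  assumes l: "l > 0"
  shows "improper_riemann_integral_exists (\<lambda>t. exp (- l * t) *\<^sub>R limit_semigroup t x)"
proof (rule improper_riemann_integral_exp_exists[OF complete l])
  show "\<exists>C. \<forall>t\<ge>0. p (limit_semigroup t x) \<le> C" if "cont_seminorm p" for p
    using limit_semigroup_bound[OF that] by blast
  fix a :: real assume a: "a \<ge> 0"
  show "\<exists>I. has_riemann_integral (\<lambda>t. exp (- l * t) *\<^sub>R limit_semigroup t x) I 0 a"
  proof (rule riemann_integral_exists[OF complete a])
    fix p :: "'a \<Rightarrow> real" and e :: real assume p: "cont_seminorm p" and e: "e > 0"
    note s = cont_seminorm_imp_seminorm[OF p]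
    let ?f = "\<lambda>t. exp (- l * t) *\<^sub>R limit_semigroup t x"
    obtain z where z: "z \<in> D" "power_sup p (x - z) < e / 4"
      using approximate_from_D[OF seq_seminorm_power_sup[OF p], of "e / 4" x] e by auto
    define C where "C = l * power_sup p x + power_sup p (A z)"
    have nonneg: "0 \<le> power_sup p y" for y
      using seminorm_nonneg seq_seminorm_imp_seminorm seq_seminorm_power_sup p by blast
    have C: "C \<ge> 0" using l nonneg by (simp add: C_def)
    have close: "p (?f u - ?f v) \<le> e / 2 + (v - u) * C" if uv: "0 \<le> u" "u \<le> v" for u v
    proof -
      have "?f u - ?f v = (exp (- l * u) - exp (- l * v)) *\<^sub>R limit_semigroup u x
          + exp (- l * v) *\<^sub>R (limit_semigroup u x - limit_semigroup v x)"
        by (simp add: algebra_simps)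
      also have "p \<dots> \<le> \<bar>exp (- l * u) - exp (- l * v)\<bar> * p (limit_semigroup u x)
          + exp (- l * v) * p (limit_semigroup u x - limit_semigroup v x)"
        by (intro order_trans[OF seminorm_add[OF s]]) (simp add: seminorm_scaleR[OF s])
      also have "\<dots> \<le> (l * (v - u)) * power_sup p x + 1 * (e / 2 + (v - u) * power_sup p (A z))"
      proof (intro add_mono mult_mono)
        have "exp (- l * u) - exp (- l * v) = exp (- l * u) * (1 - exp (- (l * (v - u))))"
          by (simp add: algebra_simps exp_add[symmetric])
        also have "\<dots> \<le> 1 * (l * (v - u))"
          using exp_ge_add_one_self[of "- (l * (v - u))"] l uv
          by (intro mult_mono) (auto intro: mult_nonneg_nonneg)
        finally show "\<bar>exp (- l * u) - exp (- l * v)\<bar> \<le> l * (v - u)"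
          using l uv by (simp add: abs_of_nonneg mult_left_mono)
        show "p (limit_semigroup u x) \<le> power_sup p x"
          using limit_semigroup_bound[OF p] uv by simp
        show "exp (- l * v) \<le> 1" using l uv by simp
        show "p (limit_semigroup u x - limit_semigroup v x) \<le> e / 2 + (v - u) * power_sup p (A z)"
          using limit_semigroup_modulus[OF p z(1), of u v x] z(2) uv by simp
      qed (use l uv seminorm_nonneg[OF s] in auto)
      also have "\<dots> = e / 2 + (v - u) * C" by (simp add: C_def algebra_simps)
      finally show ?thesis .
    qed
    define d where "d = e / (2 * (C + 1))"
    have d: "d > 0" using e C by (simp add: d_def)
    have dC: "d * C \<le> e / 2" using e C by (simp add: d_def field_simps)
    have small: "p (?f u - ?f v) \<le> e" if "0 \<le> u" "u \<le> v" "v - u < d" for u v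
      using close[OF that(1,2)] mult_right_mono[of "v - u" d C] that C dC by linarith
    have "p (?f u - ?f v) \<le> e" if "u \<in> {0..a}" "v \<in> {0..a}" "\<bar>u - v\<bar> < d" for u v
    proof (cases "u \<le> v")
      case True
      then show ?thesis using small[of u v] that by simp
    next
      case False
      then show ?thesis using small[of v u] that seminorm_diff_commute[OF s, of "?f u" "?f v"] by simp
    qed
    then show "\<exists>d>0. \<forall>u\<in>{0..a}. \<forall>v\<in>{0..a}. \<bar>u - v\<bar> < d \<longrightarrow> p (?f u - ?f v) \<le> e"
      using d by blast
  qed
qed

sublocale laplace_semigroup limit_semigroup
  by unfold_locales (rule limit_semigroup_C0, rule improper_riemann_integral_limit_semigroup)

text \<open>Summing \<open>J n - 1 = (1 / L n) (J n \<circ> A)\<close> along the powers expresses the left-hand side by differences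
  between powers of \<open>J n\<close> at \<open>A x\<close> and \<open>A x\<close> itself, each with weight \<open>1 / L n\<close>; the factor \<open>h\<close> is the
  limit of the number of steps times their length.\<close>

lemma limit_semigroup_first_order:
  assumes p: "cont_seminorm p" and x: "x \<in> D" and z: "z \<in> D" and h: "h \<ge> 0"
  shows "p (limit_semigroup h x - x - h *\<^sub>R A x) \<le>
    h * (2 * power_sup p (A x - z) + h * power_sup p (A z))"
proof (rule seq_seminorm_le_limit[OF cont_seminorm_imp_seq_seminorm[OF p]])
  note s = cont_seminorm_imp_seminorm[OF p]
  have nonneg: "0 \<le> power_sup p y" for y
    using seminorm_nonneg seq_seminorm_imp_seminorm seq_seminorm_power_sup p by blast
  show "(\<lambda>n. (J n ^^ steps n h) x - x - (real (steps n h) / L n) *\<^sub>R A x) \<longlonglongrightarrow> limit_semigroup h x - x - h *\<^sub>R A x"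
    by (intro tendsto_diff J_steps_tendsto tendsto_scaleR_lc steps_tendsto tendsto_const h)
  show "(\<lambda>n. real (steps n h) / L n * (2 * power_sup p (A x - z) + real (steps n h) / L n * power_sup p (A z)))
      \<longlonglongrightarrow> h * (2 * power_sup p (A x - z) + h * power_sup p (A z))"
    by (intro tendsto_intros steps_tendsto h)
  have "p ((J n ^^ k) x - x - (real k / L n) *\<^sub>R A x) \<le>
      real k / L n * (2 * power_sup p (A x - z) + real k / L n * power_sup p (A z))" for n k
  proof -
    have sum: "(J n ^^ k) x - x - (real k / L n) *\<^sub>R A x
        = (\<Sum>j<k. (1 / L n) *\<^sub>R ((J n ^^ Suc j) (A x) - A x))"
      using J_power_diff[OF x, of 0 k n]
      by (simp add: atLeast0LessThan scaleR_diff_right sum_subtractf sum_constant_scaleR)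
    have "p (\<Sum>j<k. (1 / L n) *\<^sub>R ((J n ^^ Suc j) (A x) - A x))
        \<le> (\<Sum>j<k. (1 / L n) * (2 * power_sup p (A x - z) + real k / L n * power_sup p (A z)))"
    proof (intro order_trans[OF seminorm_sum[OF s]] sum_mono)
      fix j assume "j \<in> {..<k}"
      then have "real (Suc j) / L n \<le> real k / L n"
        using L_pos[of n] by (intro divide_right_mono) auto
      then have "real (Suc j) / L n * power_sup p (A z) \<le> real k / L n * power_sup p (A z)"
        by (rule mult_right_mono[OF _ nonneg])
      then have "p ((J n ^^ Suc j) (A x) - A x) \<le> 2 * power_sup p (A x - z) + real k / L n * power_sup p (A z)"
        using J_power_modulus[OF p z, of "Suc j" n "A x" 0] L_pos[of n] by simp
      then have "(1 / L n) * p ((J n ^^ Suc j) (A x) - A x) \<le>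
          (1 / L n) * (2 * power_sup p (A x - z) + real k / L n * power_sup p (A z))"
        using L_pos[of n] by (intro mult_left_mono) simp_all
      then show "p ((1 / L n) *\<^sub>R ((J n ^^ Suc j) (A x) - A x)) \<le>
          (1 / L n) * (2 * power_sup p (A x - z) + real k / L n * power_sup p (A z))"
        using L_pos[of n] by (simp add: seminorm_scaleR[OF s])
    qed
    then show ?thesis unfolding sum by simp
  qed
  then show "\<forall>\<^sub>F n in sequentially. p ((J n ^^ steps n h) x - x - (real (steps n h) / L n) *\<^sub>R A x) \<le>
      real (steps n h) / L n * (2 * power_sup p (A x - z) + real (steps n h) / L n * power_sup p (A z))"
    by simp
qed

lemma limit_semigroup_difference_quotient_tendsto:
  assumes x: "x \<in> D"
  shows "((\<lambda>h. (1 / h) *\<^sub>R (limit_semigroup h x - x)) \<longlongrightarrow> A x) (at_right 0)"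
proof (rule tendsto_seminormI)
  fix p :: "'a \<Rightarrow> real" assume p: "cont_seminorm p"
  note s = cont_seminorm_imp_seminorm[OF p]
  show "((\<lambda>h. p ((1 / h) *\<^sub>R (limit_semigroup h x - x) - A x)) \<longlongrightarrow> 0) (at_right 0)"
  proof (rule tendstoI)
    fix e :: real assume e: "e > 0"
    obtain z where z: "z \<in> D" "power_sup p (A x - z) < e / 4"
      using approximate_from_D[OF seq_seminorm_power_sup[OF p], of "e / 4" "A x"] e by auto
    have "((\<lambda>h. h * power_sup p (A z)) \<longlongrightarrow> 0 * power_sup p (A z)) (at_right 0)"
      by (intro tendsto_intros)
    then have "eventually (\<lambda>h. h * power_sup p (A z) < e / 2) (at_right 0)"
      using e by (intro order_tendstoD) auto
    then show "\<forall>\<^sub>F h in at_right 0. dist (p ((1 / h) *\<^sub>R (limit_semigroup h x - x) - A x)) 0 < e"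
      using eventually_at_right_less[of 0]
    proof eventually_elim
      case (elim h)
      have "(1 / h) *\<^sub>R (limit_semigroup h x - x) - A x = (1 / h) *\<^sub>R (limit_semigroup h x - x - h *\<^sub>R A x)"
        using elim by (simp add: scaleR_diff_right)
      then have "p ((1 / h) *\<^sub>R (limit_semigroup h x - x) - A x)
          = (1 / h) * p (limit_semigroup h x - x - h *\<^sub>R A x)"
        using elim by (simp only: seminorm_scaleR[OF s]) simp
      also have "\<dots> \<le> (1 / h) * (h * (2 * power_sup p (A x - z) + h * power_sup p (A z)))"
        using elim by (intro mult_left_mono limit_semigroup_first_order p x z) simp_all
      also have "\<dots> < e" using elim z(2) by simp
      finally show ?case using seminorm_nonneg[OF s] by (simp add: abs_of_nonneg)
    qed
  qed
qed

text \<open>The generator extends \<open>A\<close>. For \<open>x\<close> in its domain, surjectivity of \<open>L 0 - A\<close> yields \<open>y\<close> in \<open>D\<close> with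
  the same image as \<open>x\<close> under \<open>L 0\<close> minus the generator, and injectivity of the latter gives \<open>y = x\<close>.\<close>

lemma is_generator_limit_semigroup: "is_generator D A limit_semigroup"
proof -
  have sub: "x \<in> generator_domain limit_semigroup" "generator limit_semigroup x = A x" if "x \<in> D" for x
    using generatorI[of limit_semigroup x] limit_semigroup_difference_quotient_tendsto[OF that] by blast+
  have "x \<in> D" if x: "x \<in> generator_domain limit_semigroup" for x
  proof -
    let ?B = "\<lambda>x. L 0 *\<^sub>R x - generator limit_semigroup x"
    define y where "y = resolvent D A (L 0) (?B x)"
    have y: "y \<in> D" "L 0 *\<^sub>R y - A y = ?B x"
      unfolding y_def by (rule resolvent_in_D, rule resolvent_right)
    then have "?B y = ?B x" by (simp add: sub)
    then have "y = x"
      using bij_betw_imp_inj_on[OF bij_betw_generator[OF L_pos[of 0]]] sub(1)[OF y(1)] x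
      by (auto dest: inj_onD)
    then show ?thesis using y by simp
  qed
  then show ?thesis
    unfolding is_generator_def using sub by auto
qed

end

section \<open>Generation theorem\<close>

theorem theorem3p38:
  fixes D :: "'a::locally_convex_t2_space set" and A :: "'a \<Rightarrow> 'a"
  assumes "linear_operator D A"
  shows
    "((\<exists>T. C0_seq_equicontinuous_semigroup T \<and> is_generator D A T \<and>
          (\<forall>x. \<forall>l>0. improper_riemann_integral_exists (\<lambda>t. exp (- l * t) *\<^sub>R T t x)))
      \<longrightarrow>
      (seq_closed_operator D A \<and> seq_dense D \<and>
        (\<exists>l :: nat \<Rightarrow> real. (\<forall>n. l n \<in> resolvent_set0 D A) \<and> filterlim l at_top sequentially \<and>
          seq_equicontinuous (UNIV :: (nat \<times> nat) set)
            (\<lambda>(n, m). (\<lambda>x. l n *\<^sub>R resolvent D A (l n) x) ^^ m))))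
     \<and>
     ((\<forall>xs :: nat \<Rightarrow> 'a. tvs_Cauchy xs \<longrightarrow> convergent xs)
      \<longrightarrow>
      (seq_closed_operator D A \<and> seq_dense D \<and>
        (\<exists>l :: nat \<Rightarrow> real. (\<forall>n. l n \<in> resolvent_set0 D A) \<and> filterlim l at_top sequentially \<and>
          seq_equicontinuous (UNIV :: (nat \<times> nat) set)
            (\<lambda>(n, m). (\<lambda>x. l n *\<^sub>R resolvent D A (l n) x) ^^ m)))
      \<longrightarrow>
      (\<exists>T. C0_seq_equicontinuous_semigroup T \<and> is_generator D A T \<and>
          (\<forall>x. \<forall>l>0. improper_riemann_integral_exists (\<lambda>t. exp (- l * t) *\<^sub>R T t x))))"
proof ((rule conjI; intro impI), goal_cases)
  case 1
  then obtain T where T: "C0_seq_equicontinuous_semigroup T" "is_generator D A T"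
    and int: "\<And>x l. l > 0 \<Longrightarrow> improper_riemann_integral_exists (\<lambda>t. exp (- l * t) *\<^sub>R T t x)"
    by blast
  interpret laplace_semigroup T by unfold_locales (rule T(1), rule int)
  have D: "D = generator_domain T" and A: "\<And>x. x \<in> D \<Longrightarrow> A x = generator T x"
    using T(2) by (auto simp: is_generator_def)
  have bij: "bij_betw (\<lambda>x. l *\<^sub>R x - A x) D UNIV" if "l > 0" for l
    using bij_betw_generator[OF that] bij_betw_cong[of D "\<lambda>x. l *\<^sub>R x - A x" "\<lambda>x. l *\<^sub>R x - generator T x"]
    by (simp add: A D[symmetric])
  have resolvent: "resolvent D A l = laplace l" if "l > 0" for l
  proof
    fix x
    show "resolvent D A l x = laplace l x"
      unfolding resolvent_def
      by (rule the_inv_into_f_eq[OF bij_betw_imp_inj_on[OF bij[OF that]]])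
         (simp_all add: A D laplace_in_generator_domain generator_laplace that)
  qed
  have graph: "{(x, A x) | x. x \<in> D} = {(x, generator T x) | x. x \<in> generator_domain T}"
    using A D by force
  have "seq_closed_operator D A"
    unfolding seq_closed_operator_def graph using assms seq_closed_generator[of 1] by simp
  moreover have "seq_dense D"
    unfolding D by (rule seq_dense_generator_domain[of 1]) simp
  moreover have "\<forall>n. real (Suc n) \<in> resolvent_set0 D A"
    unfolding resolvent_set0_def seq_continuous_def using bij by (auto simp: resolvent laplace_tendsto)
  moreover have "filterlim (\<lambda>n. real (Suc n)) at_top sequentially"
    by (rule filterlim_compose[OF filterlim_real_sequentially filterlim_Suc])
  moreover have "seq_equicontinuous UNIV
      (\<lambda>(n, m). (\<lambda>x. real (Suc n) *\<^sub>R resolvent D A (real (Suc n)) x) ^^ m)"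
    using equicontinuous_laplace_powers[of "\<lambda>n. real (Suc n)"] by (simp add: resolvent del: of_nat_Suc)
  ultimately show ?case
    by - (intro conjI exI[of _ "\<lambda>n. real (Suc n)"])
next
  case 2
  then obtain L where L: "\<And>n. L n \<in> resolvent_set0 D A" "filterlim L at_top sequentially"
      "seq_equicontinuous UNIV (\<lambda>(n :: nat, m). (\<lambda>x. L n *\<^sub>R resolvent D A (L n) x) ^^ m)"
    by blast
  \<comment> \<open>finitely many of the given numbers may be nonpositive; they are dropped\<close>
  have "eventually (\<lambda>n. L n > 0) sequentially"
    using L(2) by (simp add: filterlim_at_top_dense)
  then obtain N where N: "\<And>n. n \<ge> N \<Longrightarrow> L n > 0" by (auto simp: eventually_sequentially)
  interpret hille_yosida D A "\<lambda>n. L (n + N)"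
  proof
    show "seq_equicontinuous UNIV (\<lambda>(n, m). (\<lambda>x. L (n + N) *\<^sub>R resolvent D A (L (n + N)) x) ^^ m)"
      using equicontinuous_reindex[OF L(3), of "\<lambda>(n, m). (n + N, m)" UNIV] by (simp add: case_prod_unfold)
    show "filterlim (\<lambda>n. L (n + N)) at_top sequentially"
      by (rule filterlim_compose[OF L(2) filterlim_add_const_nat_at_top])
    show "bij_betw (\<lambda>x. L (n + N) *\<^sub>R x - A x) D UNIV" for n
      using L(1)[of "n + N"] by (simp add: resolvent_set0_def)
  qed (use 2 assms N in auto)
  show ?case
    using limit_semigroup_C0 is_generator_limit_semigroup improper_riemann_integral_limit_semigroup
    by (intro exI[of _ limit_semigroup] conjI allI impI)
qed

end
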